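(* Let $1\le p,q\le\infty$. The Banach space $(\oplus_{n=1}^\infty \ell_p^n)_{\ell_q}$ (where for $q=\infty$ this means the $c_0$-sum $(\oplus_{n=1}^\infty \ell_p^n)_{c_0}$) has a 1-greedy basis if and only if $p=q$.
   Context: All Banach spaces are real. $\ell_p^n$ is $\mathbb{R}^n$ with the $\ell_p$-norm (the max norm if $p=\infty$). For Banach spaces $E_n$ and $1\le q<\infty$, $(\oplus_{n=1}^\infty E_n)_{\ell_q}$ is the space of sequences $(v_n)$ with $v_n\in E_n$ and norm $\|(v_n)\|=(\sum_n\|v_n\|^q)^{1/q}<\infty$; $(\oplus_{n=1}^\infty E_n)_{c_0}$ is the space of sequences $(v_n)$ with $v_n\in E_n$ and $\|v_n\|\to 0$, with norm $\sup_n\|v_n\|$. Let $(x_i)_{i=1}^\infty$ be a Schauder basis of a Banach space $X$ with biorthogonal functionals $(x_i^* )$. For $x\in X$ and $n\ge 1$ put $$\sigma_n(x)=\inf\Big\{\Big\|x-\sum_{i\in A}a_ix_i\Big\| : (a_i)\subset\mathbb{R},\ A\subset\mathbb{N},\ |A|\le n\Big\}.$$ A set $A_n(x)\subset\mathbb{N}$ with $|A_n(x)|=n$ is a choice of indices of $n$ largest coefficients of $x$ if $\min\{|x_i^*(x)|: i\in A_n(x)\}\ge\max\{|x_i^*(x)|: i\in\mathbb{N}\setminus A_n(x)\}$, and then $G_n(x)=\sum_{i\in A_n(x)}x_i^*(x)x_i$ is called an $n$-th greedy approximant to $x$. The basis $(x_i)$ is greedy with constant $C$ if $\|x-G_n(x)\|\le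 C\,\sigma_n(x)$ for all $x\in X$, $n\ge 1$ (and every such $G_n(x)$); it is 1-greedy if this holds with $C=1$. *)

theory Defs
  imports "HOL-Analysis.Analysis" "HOL-Library.Function_Algebras"
begin

text \<open>Pointwise scalar multiplication, completing the pointwise additive structure of
  \<open>Function_Algebras\<close> to a real vector space.\<close>

instantiation "fun" :: (type, real_vector) real_vector
begin

definition "scaleR c f = (\<lambda>x. c *\<^sub>R f x)"

instance
  by standard (auto simp: scaleR_fun_def fun_eq_iff scaleR_add_right scaleR_add_left)

end

lemma scaleR_fun_apply [simp]: "(c *\<^sub>R f) x = c *\<^sub>R f x"
  by (simp add: scaleR_fun_def)

text \<open>The norms below depend on a parameter, so a normed space is not a type but a
  carrier \<open>V\<close> (a linear subspace of some real vector space) together with a norm \<open>N\<close>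
  that is meaningful on \<open>V\<close> only. Bases are indexed by \<^typ>\<open>nat\<close>, starting at \<open>0\<close>.\<close>

definition schauder_basis ::
    "'a::real_vector set \<Rightarrow> ('a \<Rightarrow> real) \<Rightarrow> (nat \<Rightarrow> 'a) \<Rightarrow> bool" where
  "schauder_basis V N x \<longleftrightarrow>
     (\<forall>i. x i \<in> V) \<and>
     (\<forall>v\<in>V. \<exists>!a::nat \<Rightarrow> real. (\<lambda>n. N (v - (\<Sum>i<n. a i *\<^sub>R x i))) \<longlonglongrightarrow> 0)"

text \<open>The biorthogonal functionals; \<open>basis_coeff N x v i\<close> is \<open>x\<^sub>i\<^sup>*(v)\<close>.\<close>

definition basis_coeff :: "('a::real_vector \<Rightarrow> real) \<Rightarrow> (nat \<Rightarrow> 'a) \<Rightarrow> 'a \<Rightarrow> nat \<Rightarrow> real" where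
  "basis_coeff N x v = (THE a. (\<lambda>n. N (v - (\<Sum>i<n. a i *\<^sub>R x i))) \<longlonglongrightarrow> 0)"

definition best_nterm_error :: "('a::real_vector \<Rightarrow> real) \<Rightarrow> (nat \<Rightarrow> 'a) \<Rightarrow> nat \<Rightarrow> 'a \<Rightarrow> real" where
  "best_nterm_error N x n v =
     Inf {N (v - (\<Sum>i\<in>A. a i *\<^sub>R x i)) |(a::nat \<Rightarrow> real) A. finite A \<and> card A \<le> n}"

definition largest_coeffs ::
    "('a::real_vector \<Rightarrow> real) \<Rightarrow> (nat \<Rightarrow> 'a) \<Rightarrow> nat \<Rightarrow> 'a \<Rightarrow> nat set \<Rightarrow> bool" where
  "largest_coeffs N x n v A \<longleftrightarrow>
     finite A \<and> card A = n \<and>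
     (\<forall>i\<in>A. \<forall>j\<in>-A. \<bar>basis_coeff N x v i\<bar> \<ge> \<bar>basis_coeff N x v j\<bar>)"

definition greedy_approximant ::
    "('a::real_vector \<Rightarrow> real) \<Rightarrow> (nat \<Rightarrow> 'a) \<Rightarrow> 'a \<Rightarrow> nat set \<Rightarrow> 'a" where
  "greedy_approximant N x v A = (\<Sum>i\<in>A. basis_coeff N x v i *\<^sub>R x i)"

definition greedy_basis ::
    "real \<Rightarrow> 'a::real_vector set \<Rightarrow> ('a \<Rightarrow> real) \<Rightarrow> (nat \<Rightarrow> 'a) \<Rightarrow> bool" where
  "greedy_basis C V N x \<longleftrightarrow>
     schauder_basis V N x \<and>
     (\<forall>v\<in>V. \<forall>n\<ge>1. \<forall>A. largest_coeffs N x n v A \<longrightarrow>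
        N (v - greedy_approximant N x v A) \<le> C * best_nterm_error N x n v)"

abbreviation one_greedy_basis ::
    "'a::real_vector set \<Rightarrow> ('a \<Rightarrow> real) \<Rightarrow> (nat \<Rightarrow> 'a) \<Rightarrow> bool" where
  "one_greedy_basis \<equiv> greedy_basis 1"

text \<open>\<open>\<ell>\<^sub>p\<^sup>n\<close>, realised on the real sequences vanishing from index \<open>n\<close> on; only \<open>n \<ge> 1\<close> is
  meaningful for the max norm.\<close>

definition lp_fin :: "nat \<Rightarrow> (nat \<Rightarrow> real) set" where
  "lp_fin n = {x. \<forall>i\<ge>n. x i = 0}"

definition lp_fin_norm :: "ereal \<Rightarrow> nat \<Rightarrow> (nat \<Rightarrow> real) \<Rightarrow> real" where
  "lp_fin_norm p n x =
     (if p = \<infinity> then Max ((\<lambda>i. \<bar>x i\<bar>) ` {..<n})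
      else (\<Sum>i<n. \<bar>x i\<bar> powr real_of_ereal p) powr (1 / real_of_ereal p))"

text \<open>The \<open>\<ell>\<^sub>q\<close>-sum of the normed spaces \<open>(E n, N n)\<close>; for \<open>q = \<infinity>\<close> it is the
  \<open>c\<^sub>0\<close>-sum.\<close>

definition lq_sum :: "ereal \<Rightarrow> (nat \<Rightarrow> 'a set) \<Rightarrow> (nat \<Rightarrow> 'a \<Rightarrow> real) \<Rightarrow> (nat \<Rightarrow> 'a) set" where
  "lq_sum q E N =
     {v. (\<forall>n. v n \<in> E n) \<and>
         (if q = \<infinity> then (\<lambda>n. N n (v n)) \<longlonglongrightarrow> 0
          else summable (\<lambda>n. N n (v n) powr real_of_ereal q))}"

definition lq_sum_norm :: "ereal \<Rightarrow> (nat \<Rightarrow> 'a \<Rightarrow> real) \<Rightarrow> (nat \<Rightarrow> 'a) \<Rightarrow> real" where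
  "lq_sum_norm q N v =
     (if q = \<infinity> then (SUP n. N n (v n))
      else (\<Sum>n. N n (v n) powr real_of_ereal q) powr (1 / real_of_ereal q))"

text \<open>The sum of \<open>\<ell>\<^sub>p\<^sup>1, \<ell>\<^sub>p\<^sup>2, \<dots>\<close>: since sequences start at index \<open>0\<close>, summand number
  \<open>n\<close> has dimension \<open>n + 1\<close>.\<close>

definition mixed_space :: "ereal \<Rightarrow> ereal \<Rightarrow> (nat \<Rightarrow> nat \<Rightarrow> real) set" where
  "mixed_space p q = lq_sum q (\<lambda>n. lp_fin (Suc n)) (\<lambda>n. lp_fin_norm p (Suc n))"

definition mixed_norm :: "ereal \<Rightarrow> ereal \<Rightarrow> (nat \<Rightarrow> nat \<Rightarrow> real) \<Rightarrow> real" where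
  "mixed_norm p q = lq_sum_norm q (\<lambda>n. lp_fin_norm p (Suc n))"

end

theory Submission
  imports Defs
begin

text \<open>Write \<open>a \<oplus> b = (a\<^sup>q + b\<^sup>q)\<^bsup>1/q\<^esup>\<close> (the maximum if \<open>q = \<infinity>\<close>). If \<open>x\<close> is 1-greedy, then the norm of
  \<open>v + \<Sum>\<^bsub>i\<in>F\<^esub> \<plusminus> t x\<^sub>i\<close> depends only on \<open>v\<close>, \<open>t\<close> and \<open>card F\<close>, provided that the coefficients of \<open>v\<close> have
  modulus at most \<open>t\<close> and \<open>F\<close> avoids its support. Moving \<open>F\<close> to infinity and using the gliding hump in
  the \<open>\<ell>\<^sub>q\<close>-sum gives \<open>N (v + t x\<^sub>i) = N v \<oplus> \<bar>t\<bar> N x\<^sub>i\<close>; so the space is isometric to \<open>\<ell>\<^sub>q\<close> (or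
  \<open>c\<^sub>0\<close>) via \<open>x\<close>. If \<open>q = 2\<close>, the parallelogram law for two unit vectors of one summand gives
  \<open>p = 2\<close>. If \<open>q \<noteq> 2\<close>, isometric involutions permute the \<open>x\<^sub>i\<close> up to sign. Applied to the sign change
  of a coordinate, this shows that every unit vector \<open>e\<close> is a multiple of some \<open>x\<^sub>i\<close> or some
  \<open>x\<^sub>i \<plusminus> x\<^sub>j\<close>. Of three unit vectors in one summand, two must have disjoint supports with respect to
  \<open>x\<close>; the norm of their sum is \<open>2\<^bsup>1/q\<^esup>\<close> as well as \<open>2\<^bsup>1/p\<^esup>\<close>. Conversely, for \<open>p = q\<close> the unit vectors form a
  basis with \<open>N (w + s x\<^sub>i) = N w \<oplus> \<bar>s\<bar>\<close> for \<open>i\<close> outside the support of \<open>w\<close>, and such a basis is 1-greedy.\<close>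

subsection \<open>Two-term \<open>\<ell>\<^sub>q\<close>-sums\<close>

text \<open>For 1 <= q <= infinity this is a commutative monoid with unit 0 on the nonnegative
  reals. Most later arguments use only its algebra, monotonicity and Lipschitz bound, so finite and
  infinite \<open>q\<close> are treated together.\<close>

definition lq_add :: "ereal \<Rightarrow> real \<Rightarrow> real \<Rightarrow> real" where
  "lq_add q a b =
     (if q = \<infinity> then max a b
      else (a powr real_of_ereal q + b powr real_of_ereal q) powr (1 / real_of_ereal q))"

lemma ereal_ge_1_cases [consumes 1, case_names infinite real]:
  assumes "1 \<le> (q::ereal)"
  obtains "q = \<infinity>" | r where "q = ereal r" "1 \<le> r"
  using assms by (cases q) auto

lemma powr_root_powr: "0 \<le> x \<Longrightarrow> r \<noteq> 0 \<Longrightarrow> (x powr r) powr (1 / r) = (x::real)"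
  by (simp add: powr_powr)

lemma root_powr_powr: "0 \<le> x \<Longrightarrow> r \<noteq> 0 \<Longrightarrow> (x powr (1 / r)) powr r = (x::real)"
  by (simp add: powr_powr)

lemma lq_add_infty [simp]: "lq_add \<infinity> a b = max a b"
  by (simp add: lq_add_def)

lemma lq_add_ereal: "lq_add (ereal r) a b = (a powr r + b powr r) powr (1 / r)"
  by (simp add: lq_add_def)

lemma lq_add_powr:
  "1 \<le> r \<Longrightarrow> lq_add (ereal r) a b powr r = a powr r + b powr r"
  by (simp add: lq_add_ereal root_powr_powr)

lemma lq_add_1: "0 \<le> a \<Longrightarrow> 0 \<le> b \<Longrightarrow> lq_add 1 a b = a + b"
  unfolding one_ereal_def by (simp add: lq_add_ereal)

lemma lq_add_commute: "lq_add q a b = lq_add q b a"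
  by (simp add: lq_add_def max.commute add.commute)

lemma lq_add_nonneg: "0 \<le> a \<Longrightarrow> 0 \<le> b \<Longrightarrow> 0 \<le> lq_add q a b"
  by (auto simp: lq_add_def)

lemma lq_add_assoc:
  assumes "1 \<le> q"
  shows "lq_add q (lq_add q a b) c = lq_add q a (lq_add q b c)"
  using assms
proof (cases rule: ereal_ge_1_cases)
  case (real r)
  then show ?thesis by (simp add: lq_add_ereal root_powr_powr add.assoc)
qed (simp add: max.assoc)

lemma lq_add_right_commute:
  "1 \<le> q \<Longrightarrow> lq_add q (lq_add q a b) c = lq_add q (lq_add q a c) b"
  by (metis lq_add_assoc lq_add_commute)

lemma lq_add_0_right [simp]: "1 \<le> q \<Longrightarrow> 0 \<le> a \<Longrightarrow> lq_add q a 0 = a"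
  by (cases q rule: ereal_ge_1_cases) (auto simp: lq_add_ereal powr_root_powr)

lemma lq_add_0_left [simp]: "1 \<le> q \<Longrightarrow> 0 \<le> a \<Longrightarrow> lq_add q 0 a = a"
  by (subst lq_add_commute) simp

lemma lq_add_mono:
  assumes "1 \<le> q" "0 \<le> a" "0 \<le> b" "a \<le> a'" "b \<le> b'"
  shows "lq_add q a b \<le> lq_add q a' b'"
  using assms(1)
proof (cases rule: ereal_ge_1_cases)
  case (real r)
  then show ?thesis using assms unfolding lq_add_ereal real
    by (intro powr_mono2 add_mono) auto
qed (use assms in auto)

lemma lq_add_ge_left: "1 \<le> q \<Longrightarrow> 0 \<le> a \<Longrightarrow> 0 \<le> b \<Longrightarrow> a \<le> lq_add q a b"
  using lq_add_mono[of q a 0 a b] by simp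

lemma lq_add_ge_right: "1 \<le> q \<Longrightarrow> 0 \<le> a \<Longrightarrow> 0 \<le> b \<Longrightarrow> b \<le> lq_add q a b"
  using lq_add_mono[of q 0 b a b] by simp

lemma lq_add_mult:
  assumes "1 \<le> q" "0 \<le> c" "0 \<le> a" "0 \<le> b"
  shows "lq_add q (c * a) (c * b) = c * lq_add q a b"
  using assms(1)
proof (cases rule: ereal_ge_1_cases)
  case (real r)
  then show ?thesis using assms
    by (simp add: lq_add_ereal powr_mult powr_root_powr flip: distrib_left)
qed (use assms in \<open>auto simp: max_mult_distrib_left\<close>)

text \<open>If one of the two points is 0, the inequality reduces to \<open>s powr r \<le> s\<close>
  for 0 < s < 1; otherwise both points are positive and convexity on the open half-line
  applies.\<close>

lemma convex_on_powr_nonneg: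
  assumes "1 \<le> r" shows "convex_on {0..} (\<lambda>x::real. x powr r)"
proof (rule convex_onI)
  fix t x y :: real
  assume t: "0 < t" "t < 1" and xy: "x \<in> {0..}" "y \<in> {0..}"
  have le: "s powr r \<le> s" if "0 < s" "s < 1" for s :: real
    using powr_mono'[of 1 r s] that assms by simp
  show "((1 - t) *\<^sub>R x + t *\<^sub>R y) powr r \<le> (1 - t) * x powr r + t * y powr r"
  proof (cases "x = 0 \<or> y = 0")
    case True
    then show ?thesis
      using t xy le[of t] le[of "1 - t"] by (auto simp: powr_mult mult_right_mono)
  next
    case False
    then show ?thesis
      using convex_onD[OF powr_convex[OF assms], of t x y] t xy by auto
  qed
qed auto

text \<open>Minkowski's inequality in the plane. Both vectors are normalised by their norms
  \<open>H\<close> and \<open>H'\<close>; the normalised sum is then their convex combination with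
  weights H/(H + H') and H'/(H + H'), and convexity of the r-th power is applied in each
  coordinate.\<close>

lemma lq_add_triangle:
  assumes q: "1 \<le> q" and nn: "0 \<le> a" "0 \<le> b" "0 \<le> a'" "0 \<le> b'"
  shows "lq_add q (a + a') (b + b') \<le> lq_add q a b + lq_add q a' b'"
proof -
  define H where "H = lq_add q a b"
  define H' where "H' = lq_add q a' b'"
  have ge: "a \<le> H" "b \<le> H" "a' \<le> H'" "b' \<le> H'"
    unfolding H_def H'_def using q nn by (auto intro: lq_add_ge_left lq_add_ge_right)
  from q show ?thesis
  proof (cases rule: ereal_ge_1_cases)
    case infinite
    then show ?thesis by auto
  next
    case (real r)
    consider "H = 0" | "H' = 0" | "0 < H" "0 < H'" using ge nn by linarith
    then show ?thesis
    proof cases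
      case 1
      then have "a = 0" "b = 0" using ge nn by auto
      then show ?thesis using q by simp
    next
      case 2
      then have "a' = 0" "b' = 0" using ge nn by auto
      then show ?thesis using q by simp
    next
      case 3
      define l where "l = H' / (H + H')"
      have l: "0 \<le> l" "l \<le> 1" "1 - l = H / (H + H')" using 3 by (auto simp: l_def field_simps)
      have conv: "((x + x') / (H + H')) powr r
          \<le> (1 - l) * (x powr r / H powr r) + l * (x' powr r / H' powr r)"
        if "0 \<le> x" "0 \<le> x'" for x x'
      proof -
        have "((1 - l) *\<^sub>R (x / H) + l *\<^sub>R (x' / H')) powr r
            \<le> (1 - l) * (x / H) powr r + l * (x' / H') powr r"
          using convex_onD[OF convex_on_powr_nonneg[OF \<open>1 \<le> r\<close>], of l "x / H" "x' / H'"]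
            l that 3 by simp
        also have "(1 - l) *\<^sub>R (x / H) + l *\<^sub>R (x' / H') = (x + x') / (H + H')"
          unfolding l(3) using 3 by (simp add: l_def add_divide_distrib)
        finally show ?thesis using that 3 by (simp add: powr_divide)
      qed
      have e: "a powr r + b powr r = H powr r" "a' powr r + b' powr r = H' powr r"
        using real by (simp_all add: H_def H'_def lq_add_powr)
      have pos: "H powr r > 0" "H' powr r > 0" using 3 by auto
      have "((a + a') / (H + H')) powr r + ((b + b') / (H + H')) powr r
        \<le> (1 - l) * ((a powr r + b powr r) / H powr r) + l * ((a' powr r + b' powr r) / H' powr r)"
        using conv[of a a'] conv[of b b'] nn by (simp add: add_divide_distrib distrib_left)
      also have "\<dots> = 1" using pos unfolding e by simp
      finally have "((a + a') powr r + (b + b') powr r) / (H + H') powr r \<le> 1"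
        using nn 3 by (simp add: powr_divide flip: add_divide_distrib)
      then have "(a + a') powr r + (b + b') powr r \<le> (H + H') powr r"
        using 3 by (simp add: divide_le_eq)
      then have "((a + a') powr r + (b + b') powr r) powr (1 / r) \<le> ((H + H') powr r) powr (1 / r)"
        using real by (intro powr_mono2) auto
      then have "lq_add q (a + a') (b + b') \<le> H + H'"
        using 3 real by (simp add: powr_root_powr lq_add_ereal)
      then show ?thesis by (simp add: H_def H'_def)
    qed
  qed
qed

lemma lq_add_le_add:
  assumes "1 \<le> q" "0 \<le> a" "0 \<le> b" shows "lq_add q a b \<le> a + b"
  using lq_add_triangle[of q a 0 0 b] assms by simp

text \<open>Each argument is at most the other one plus the distance; monotonicity, the triangle
  inequality and \<open>lq_add_le_add\<close> do the rest. This bound carries limits and small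
  perturbations through \<open>lq_add\<close> for all \<open>q\<close> at once.\<close>

lemma lq_add_lipschitz:
  assumes q: "1 \<le> q" and "0 \<le> a" "0 \<le> b" "0 \<le> a'" "0 \<le> b'"
  shows "\<bar>lq_add q a b - lq_add q a' b'\<bar> \<le> \<bar>a - a'\<bar> + \<bar>b - b'\<bar>"
proof -
  have "lq_add q x y - lq_add q x' y' \<le> \<bar>x - x'\<bar> + \<bar>y - y'\<bar>"
    if "0 \<le> x" "0 \<le> y" "0 \<le> x'" "0 \<le> y'" for x y x' y'
  proof -
    have "lq_add q x y \<le> lq_add q (x' + \<bar>x - x'\<bar>) (y' + \<bar>y - y'\<bar>)"
      using that q by (intro lq_add_mono) auto
    also have "\<dots> \<le> lq_add q x' y' + lq_add q \<bar>x - x'\<bar> \<bar>y - y'\<bar>"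
      using that q by (intro lq_add_triangle) auto
    also have "lq_add q \<bar>x - x'\<bar> \<bar>y - y'\<bar> \<le> \<bar>x - x'\<bar> + \<bar>y - y'\<bar>"
      using q by (intro lq_add_le_add) auto
    finally show ?thesis by simp
  qed
  from this[of a b a' b'] this[of a' b' a b] assms show ?thesis
    by (simp add: abs_le_iff abs_minus_commute)
qed

lemma tendsto_lq_add:
  assumes q: "1 \<le> q" and f: "(f \<longlongrightarrow> a) F" and g: "(g \<longlongrightarrow> b) F"
    and nn: "\<And>x. 0 \<le> f x" "\<And>x. 0 \<le> g x" "0 \<le> a" "0 \<le> b"
  shows "((\<lambda>x. lq_add q (f x) (g x)) \<longlongrightarrow> lq_add q a b) F"
proof (rule Lim_transform2[OF tendsto_const], rule tendsto_0_le[where K = 1])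
  show "((\<lambda>x. \<bar>f x - a\<bar> + \<bar>g x - b\<bar>) \<longlongrightarrow> 0) F"
    using tendsto_add[OF tendsto_rabs_zero tendsto_rabs_zero, of "\<lambda>x. f x - a" F "\<lambda>x. g x - b"] f g
    by (simp add: LIM_zero)
  show "\<forall>\<^sub>F x in F. norm (lq_add q a b - lq_add q (f x) (g x)) \<le> norm (\<bar>f x - a\<bar> + \<bar>g x - b\<bar>) * 1"
  proof (rule always_eventually, rule allI)
    fix x show "norm (lq_add q a b - lq_add q (f x) (g x)) \<le> norm (\<bar>f x - a\<bar> + \<bar>g x - b\<bar>) * 1"
      using lq_add_lipschitz[OF q nn(3,4) nn(1,2), of x x] by (simp add: abs_minus_commute)
  qed
qed

text \<open>The common value is 2^(1/q), read as 1 for infinite \<open>q\<close>, and it determines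
  the exponent. Both cases of the forward direction end here.\<close>

lemma lq_add_same_inject:
  assumes "1 \<le> p" "1 \<le> q" "lq_add p 1 1 = lq_add q 1 1"
  shows "p = q"
  using assms(1)
proof (cases rule: ereal_ge_1_cases)
  case infinite
  with assms(2,3) show ?thesis
    by (cases q rule: ereal_ge_1_cases) (auto simp: lq_add_ereal powr_eq_one_iff)
next
  case (real r)
  with assms(2,3) show ?thesis
    by (cases q rule: ereal_ge_1_cases) (auto simp: lq_add_ereal powr_inj)
qed

subsection \<open>Sequences in \<open>\<ell>\<^sub>q\<close> and \<open>c\<^sub>0\<close>\<close>

text \<open>The recursion lets each law of \<open>lq_add\<close> pass to sequences by induction,
  uniformly in \<open>q\<close>. The usual power sum and maximum are recovered in
  \<open>lq_fold_ereal\<close> and \<open>lq_fold_infty\<close>.\<close>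

primrec lq_fold :: "ereal \<Rightarrow> (nat \<Rightarrow> real) \<Rightarrow> nat \<Rightarrow> real" where
  "lq_fold q g 0 = 0"
| "lq_fold q g (Suc n) = lq_add q (lq_fold q g n) (g n)"

lemma lq_fold_nonneg: "(\<And>n. 0 \<le> g n) \<Longrightarrow> 0 \<le> lq_fold q g n"
  by (induction n) (auto intro: lq_add_nonneg)

lemma lq_fold_cong:
  assumes "\<And>i. i < n \<Longrightarrow> g i = g' i" shows "lq_fold q g n = lq_fold q g' n"
proof -
  have "m \<le> n \<Longrightarrow> lq_fold q g m = lq_fold q g' m" for m
    by (induction m) (simp_all add: assms)
  then show ?thesis by blast
qed

lemma lq_fold_zero: "1 \<le> q \<Longrightarrow> lq_fold q (\<lambda>_. 0) n = 0"
  by (induction n) auto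

lemma lq_fold_mono:
  assumes "1 \<le> q" "\<And>n. 0 \<le> g n" "\<And>n. g n \<le> g' n"
  shows "lq_fold q g n \<le> lq_fold q g' n"
  using assms by (induction n) (auto intro!: lq_add_mono lq_fold_nonneg)

lemma lq_fold_triangle:
  assumes "1 \<le> q" "\<And>n. 0 \<le> g n" "\<And>n. 0 \<le> g' n"
  shows "lq_fold q (\<lambda>n. g n + g' n) n \<le> lq_fold q g n + lq_fold q g' n"
proof (induction n)
  case (Suc n)
  have "lq_fold q (\<lambda>n. g n + g' n) (Suc n)
      \<le> lq_add q (lq_fold q g n + lq_fold q g' n) (g n + g' n)"
    using assms Suc by (auto intro!: lq_add_mono lq_fold_nonneg)
  also have "\<dots> \<le> lq_fold q g (Suc n) + lq_fold q g' (Suc n)"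
    using assms by (auto intro!: lq_add_triangle lq_fold_nonneg)
  finally show ?case .
qed simp

lemma lq_fold_mult:
  assumes "1 \<le> q" "\<And>n. 0 \<le> g n" "0 \<le> c"
  shows "lq_fold q (\<lambda>n. c * g n) n = c * lq_fold q g n"
  using assms by (induction n) (auto simp: lq_add_mult lq_fold_nonneg)

lemma lq_fold_ge:
  assumes "1 \<le> q" "\<And>n. 0 \<le> g n" "k < n"
  shows "g k \<le> lq_fold q g n"
  using assms(3)
proof (induction n)
  case (Suc n)
  have "g n \<le> lq_add q (lq_fold q g n) (g n)" "lq_fold q g n \<le> lq_add q (lq_fold q g n) (g n)"
    using assms lq_fold_nonneg[of g q n] by (auto intro: lq_add_ge_right lq_add_ge_left)
  with Suc show ?case by (cases "k = n") auto
qed simp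

lemma lq_fold_le_sum:
  assumes "1 \<le> q" "\<And>n. 0 \<le> g n"
  shows "lq_fold q g n \<le> (\<Sum>i<n. g i)"
proof (induction n)
  case (Suc n)
  have "lq_fold q g (Suc n) \<le> lq_fold q g n + g n"
    using assms lq_fold_nonneg[of g q n] by (auto intro: lq_add_le_add)
  with Suc show ?case by simp
qed simp

text \<open>The part \<open>b\<close> of entry \<open>k\<close> moves past all later entries by
  associativity and commutativity. With \<open>a = 0\<close> this isolates a single entry.\<close>

lemma lq_fold_insert:
  assumes q: "1 \<le> q" and g: "\<And>n. 0 \<le> g n" "g k = lq_add q a b" "k < n" "0 \<le> a" "0 \<le> b"
  shows "lq_fold q g n = lq_add q (lq_fold q (g(k := a)) n) b"
  using \<open>k < n\<close>
proof (induction n)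
  case (Suc n)
  show ?case
  proof (cases "k = n")
    case True
    then have "lq_fold q (g(k := a)) n = lq_fold q g n" by (intro lq_fold_cong) auto
    with True show ?thesis using q g(2) by (simp add: lq_add_assoc del: fun_upd_apply add: fun_upd_same)
  next
    case False
    then show ?thesis using Suc q by (simp add: lq_add_right_commute)
  qed
qed simp

lemma lq_fold_split:
  assumes q: "1 \<le> q" and g: "\<And>n. 0 \<le> g n"
  shows "lq_fold q g n
    = lq_add q (lq_fold q (\<lambda>m. if m < k then g m else 0) n) (lq_fold q (\<lambda>m. if m < k then 0 else g m) n)"
proof (induction n)
  case (Suc n)
  let ?a = "lq_fold q (\<lambda>m. if m < k then g m else 0) n"
  let ?b = "lq_fold q (\<lambda>m. if m < k then 0 else g m) n"
  have "0 \<le> ?a" "0 \<le> ?b" using g by (auto intro: lq_fold_nonneg)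
  then show ?case
    using Suc q by (cases "n < k") (auto simp: lq_add_assoc, metis lq_add_assoc lq_add_commute)
qed (use q in simp)

lemma lq_fold_ereal:
  assumes "1 \<le> r" "\<And>n. 0 \<le> g n"
  shows "lq_fold (ereal r) g n = (\<Sum>i<n. g i powr r) powr (1 / r)"
proof -
  have "lq_fold (ereal r) g n powr r = (\<Sum>i<n. g i powr r)"
    by (induction n) (use assms in \<open>auto simp: lq_add_powr\<close>)
  then show ?thesis
    using assms lq_fold_nonneg[of g "ereal r" n] by (metis not_one_le_zero powr_root_powr)
qed

lemma lq_fold_infty:
  assumes "\<And>n. 0 \<le> g n"
  shows "lq_fold \<infinity> g (Suc n) = Max (g ` {..n})"
proof (induction n)
  case 0
  then show ?case using assms by (simp add: max_def)
next
  case (Suc n)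
  have "lq_fold \<infinity> g (Suc (Suc n)) = max (g (Suc n)) (Max (g ` {..n}))"
    using Suc by (simp add: max.commute)
  also have "\<dots> = Max (insert (g (Suc n)) (g ` {..n}))"
    by (subst Max_insert) auto
  also have "insert (g (Suc n)) (g ` {..n}) = g ` {..Suc n}"
    by (auto simp: atMost_Suc)
  finally show ?case .
qed

text \<open>The norm of m equal terms grows like m^(1/q), or stays bounded if \<open>q\<close> is
  infinite; both are o(m) because q > 1. The averaging argument for small basis vectors rests on
  this.\<close>

lemma lq_fold_const_sublinear:
  assumes q: "1 < q" and k: "0 \<le> k"
  shows "(\<lambda>m. lq_fold q (\<lambda>_. k) m / real m) \<longlonglongrightarrow> 0"
proof -
  have "1 \<le> q" using q by simp
  then show ?thesis
  proof (cases rule: ereal_ge_1_cases)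
    case infinite
    have "lq_fold q (\<lambda>_. k) m \<le> k" for m using k by (induction m) (auto simp: infinite)
    moreover have "0 \<le> lq_fold q (\<lambda>_. k) m" for m using k by (rule lq_fold_nonneg)
    ultimately have "norm (lq_fold q (\<lambda>_. k) m / real m) \<le> norm (k / real m) * 1" for m
      using k by (simp add: divide_right_mono)
    then show ?thesis
      by (intro tendsto_0_le[OF lim_const_over_n[of k]] always_eventually allI)
  next
    case (real r)
    then have r: "1 < r" using q by simp
    have eq: "lq_fold q (\<lambda>_. k) m / real m = k * real m powr (1 / r - 1)" if "0 < m" for m
    proof -
      have "lq_fold q (\<lambda>_. k) m = (real m * k powr r) powr (1 / r)"
        using real k by (simp add: lq_fold_ereal)
      also have "\<dots> = real m powr (1 / r) * k"
        using r k by (simp add: powr_mult powr_root_powr)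
      finally show ?thesis using that by (simp add: powr_diff)
    qed
    have "(\<lambda>m. real m powr (1 / r - 1)) \<longlonglongrightarrow> 0"
      using r by (intro tendsto_neg_powr filterlim_real_sequentially) (simp add: field_simps)
    then have "(\<lambda>m. k * real m powr (1 / r - 1)) \<longlonglongrightarrow> 0" by (rule tendsto_mult_right_zero)
    moreover have "\<forall>\<^sub>F m in sequentially. k * real m powr (1 / r - 1) = lq_fold q (\<lambda>_. k) m / real m"
      using eventually_gt_at_top[of 0] by eventually_elim (simp add: eq)
    ultimately show ?thesis by (rule Lim_transform_eventually)
  qed
qed

section \<open>Norms of infinite nonnegative sequences, obtained as limits of finite folds\<close>

definition lq_seqs :: "ereal \<Rightarrow> (nat \<Rightarrow> real) set" where
  "lq_seqs q = {g. (\<forall>n. 0 \<le> g n) \<and>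
     (if q = \<infinity> then g \<longlonglongrightarrow> 0 else summable (\<lambda>n. g n powr real_of_ereal q))}"

definition lq_norm :: "ereal \<Rightarrow> (nat \<Rightarrow> real) \<Rightarrow> real" where
  "lq_norm q g =
     (if q = \<infinity> then SUP n. g n
      else (\<Sum>n. g n powr real_of_ereal q) powr (1 / real_of_ereal q))"

lemma lq_seqs_nonneg: "g \<in> lq_seqs q \<Longrightarrow> 0 \<le> g n"
  by (simp add: lq_seqs_def)

lemma lq_seqs_mono:
  assumes q: "1 \<le> q" and g: "g \<in> lq_seqs q" and le: "\<And>n. 0 \<le> g' n" "\<And>n. g' n \<le> g n"
  shows "g' \<in> lq_seqs q"
  using q
proof (cases rule: ereal_ge_1_cases)
  case infinite
  then have "g \<longlonglongrightarrow> 0" using g by (simp add: lq_seqs_def)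
  then have "g' \<longlonglongrightarrow> 0"
    by (rule tendsto_sandwich[OF _ _ tendsto_const, rotated 2]) (use le in auto)
  then show ?thesis using le infinite by (simp add: lq_seqs_def)
next
  case (real r)
  have "summable (\<lambda>n. g' n powr r)"
  proof (rule summable_comparison_test')
    show "summable (\<lambda>n. g n powr r)" using g real by (simp add: lq_seqs_def)
    show "norm (g' n powr r) \<le> g n powr r" for n
      using le real by (simp add: powr_mono2)
  qed
  then show ?thesis using le real by (simp add: lq_seqs_def)
qed

lemma lq_seqs_mult:
  assumes q: "1 \<le> q" and g: "g \<in> lq_seqs q" and c: "0 \<le> c"
  shows "(\<lambda>n. c * g n) \<in> lq_seqs q"
  using q
proof (cases rule: ereal_ge_1_cases)
  case infinite
  then show ?thesis using g c by (auto simp: lq_seqs_def intro: tendsto_mult_right_zero)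
next
  case (real r)
  then show ?thesis using g c by (auto simp: lq_seqs_def powr_mult intro: summable_mult)
qed

lemma lq_seqs_add:
  assumes q: "1 \<le> q" and g: "g \<in> lq_seqs q" "g' \<in> lq_seqs q"
  shows "(\<lambda>n. g n + g' n) \<in> lq_seqs q"
  using q
proof (cases rule: ereal_ge_1_cases)
  case infinite
  then show ?thesis using g by (auto simp: lq_seqs_def intro: tendsto_add_zero)
next
  case (real r)
  have "summable (\<lambda>n. (g n + g' n) powr r)"
  proof (rule summable_comparison_test')
    show "summable (\<lambda>n. 2 powr r * (g n powr r + g' n powr r))"
      using g real by (auto simp: lq_seqs_def intro!: summable_mult summable_add)
    show "norm ((g n + g' n) powr r) \<le> 2 powr r * (g n powr r + g' n powr r)" for n
    proof -
      have nn: "0 \<le> g n" "0 \<le> g' n" using g by (auto simp: lq_seqs_nonneg)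
      then have "(g n + g' n) powr r \<le> (2 * max (g n) (g' n)) powr r"
        using real by (intro powr_mono2) auto
      also have "\<dots> = 2 powr r * max (g n) (g' n) powr r" using nn by (simp add: powr_mult)
      also have "\<dots> \<le> 2 powr r * (g n powr r + g' n powr r)"
        by (intro mult_left_mono) (auto simp: max_def)
      finally show ?thesis by simp
    qed
  qed
  then show ?thesis using g real by (simp add: lq_seqs_def)
qed

lemma lq_seqs_finite:
  assumes q: "1 \<le> q" and g: "\<And>n. 0 \<le> g n" "\<And>m. n \<le> m \<Longrightarrow> g m = 0"
  shows "g \<in> lq_seqs q"
  using q
proof (cases rule: ereal_ge_1_cases)
  case infinite
  have "g \<longlonglongrightarrow> 0"
    by (rule tendsto_eventually) (use g(2) eventually_sequentially in blast)
  then show ?thesis using g infinite by (simp add: lq_seqs_def)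
next
  case (real r)
  have "summable (\<lambda>m. g m powr r)"
    by (rule summable_finite[of "{..<n}"]) (use g(2) in auto)
  then show ?thesis using g real by (simp add: lq_seqs_def)
qed

text \<open>Through this limit the laws of finite folds become laws of \<open>lq_norm\<close>. For
  infinite \<open>q\<close> the folds are running maxima, which increase to the supremum; for finite
  \<open>q\<close> they are roots of partial sums.\<close>

lemma lq_fold_tendsto:
  assumes q: "1 \<le> q" and g: "g \<in> lq_seqs q"
  shows "lq_fold q g \<longlonglongrightarrow> lq_norm q g"
  using q
proof (cases rule: ereal_ge_1_cases)
  case infinite
  have nn: "0 \<le> g n" for n using g by (rule lq_seqs_nonneg)
  have bdd: "bdd_above (range g)"
  proof -
    have "g \<longlonglongrightarrow> 0" using g infinite by (simp add: lq_seqs_def)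
    then have "bounded (range g)" by (rule convergent_imp_bounded)
    then show ?thesis by (rule bounded_imp_bdd_above)
  qed
  have mono: "incseq (lq_fold q g)"
    unfolding infinite by (rule incseq_SucI) simp
  have le: "lq_fold q g n \<le> (SUP n. g n)" for n
  proof (induction n)
    case 0
    have "0 \<le> g 0" by (rule nn)
    also have "\<dots> \<le> (SUP n. g n)" using bdd by (rule cSUP_upper[OF UNIV_I])
    finally show ?case by simp
  next
    case (Suc n)
    then show ?case using infinite bdd by (simp add: cSUP_upper)
  qed
  obtain L where L: "lq_fold q g \<longlonglongrightarrow> L" "\<And>n. lq_fold q g n \<le> L"
    using incseq_convergent[OF mono, of "SUP n. g n"] le by blast
  have "L \<le> (SUP n. g n)" by (rule LIMSEQ_le_const2[OF L(1)]) (use le in auto)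
  moreover have "(SUP n. g n) \<le> L"
  proof (rule cSUP_least)
    fix n
    have "g n \<le> lq_fold q g (Suc n)" using infinite by simp
    also have "\<dots> \<le> L" by (rule L(2))
    finally show "g n \<le> L" .
  qed simp
  ultimately have "L = lq_norm q g" using infinite by (simp add: lq_norm_def)
  then show ?thesis using L(1) by simp
next
  case (real r)
  have "(\<lambda>n. \<Sum>i<n. g i powr r) \<longlonglongrightarrow> (\<Sum>i. g i powr r)"
    using g real by (intro summable_LIMSEQ) (simp add: lq_seqs_def)
  then have "(\<lambda>n. (\<Sum>i<n. g i powr r) powr (1 / r)) \<longlonglongrightarrow> (\<Sum>i. g i powr r) powr (1 / r)"
    using real by (intro tendsto_powr') (auto intro!: always_eventually sum_nonneg)
  moreover have "lq_fold q g = (\<lambda>n. (\<Sum>i<n. g i powr r) powr (1 / r))"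
    using lq_fold_ereal[OF real(2), of g] lq_seqs_nonneg[OF g] real by auto
  ultimately show ?thesis using real by (simp add: lq_norm_def)
qed

context
  fixes q :: ereal
  assumes q: "1 \<le> q"
begin

lemma lq_norm_finite:
  assumes "\<And>n. 0 \<le> g n" "\<And>m. n \<le> m \<Longrightarrow> g m = 0"
  shows "lq_norm q g = lq_fold q g n"
proof (rule LIMSEQ_unique[OF lq_fold_tendsto[OF q]])
  show "g \<in> lq_seqs q" using q assms by (rule lq_seqs_finite)
  have "lq_fold q g m = lq_fold q g n" if "n \<le> m" for m
    using that by (induction rule: dec_induct) (use assms lq_fold_nonneg[of g] q in auto)
  then show "lq_fold q g \<longlonglongrightarrow> lq_fold q g n"
    by (intro tendsto_eventually eventually_sequentiallyI)
qed

lemma lq_norm_nonneg: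
  assumes "g \<in> lq_seqs q" shows "0 \<le> lq_norm q g"
  using LIMSEQ_le_const[OF lq_fold_tendsto[OF q assms], of 0]
    lq_fold_nonneg[of g q, OF lq_seqs_nonneg[OF assms]] by blast

lemma lq_norm_mono:
  assumes "g \<in> lq_seqs q" "\<And>n. 0 \<le> g' n" "\<And>n. g' n \<le> g n"
  shows "lq_norm q g' \<le> lq_norm q g"
proof (rule LIMSEQ_le[OF lq_fold_tendsto[OF q] lq_fold_tendsto[OF q]])
  show "g' \<in> lq_seqs q" using q assms by (rule lq_seqs_mono)
  show "\<exists>N. \<forall>n\<ge>N. lq_fold q g' n \<le> lq_fold q g n"
    using lq_fold_mono[of q g' g] q assms by blast
qed fact

lemma lq_norm_mult:
  assumes "g \<in> lq_seqs q" "0 \<le> c"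
  shows "lq_norm q (\<lambda>n. c * g n) = c * lq_norm q g"
proof (rule LIMSEQ_unique[OF lq_fold_tendsto[OF q lq_seqs_mult[OF q]]])
  show "lq_fold q (\<lambda>n. c * g n) \<longlonglongrightarrow> c * lq_norm q g"
    unfolding lq_fold_mult[OF q lq_seqs_nonneg[OF assms(1)] assms(2)]
    by (intro tendsto_mult_left lq_fold_tendsto q assms)
qed (use assms in auto)

lemma lq_norm_triangle:
  assumes "g \<in> lq_seqs q" "g' \<in> lq_seqs q"
  shows "lq_norm q (\<lambda>n. g n + g' n) \<le> lq_norm q g + lq_norm q g'"
proof (rule LIMSEQ_le)
  show "lq_fold q (\<lambda>n. g n + g' n) \<longlonglongrightarrow> lq_norm q (\<lambda>n. g n + g' n)"
    by (intro lq_fold_tendsto lq_seqs_add q assms)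
  show "(\<lambda>n. lq_fold q g n + lq_fold q g' n) \<longlonglongrightarrow> lq_norm q g + lq_norm q g'"
    by (intro tendsto_add lq_fold_tendsto q assms)
  show "\<exists>N. \<forall>n\<ge>N. lq_fold q (\<lambda>n. g n + g' n) n \<le> lq_fold q g n + lq_fold q g' n"
    using lq_fold_triangle[of q g g'] q assms lq_seqs_nonneg by blast
qed

lemma lq_norm_ge:
  assumes "g \<in> lq_seqs q" shows "g n \<le> lq_norm q g"
proof -
  let ?s = "\<lambda>m. if m = n then g n else 0"
  have nn: "0 \<le> g n" for n using assms by (rule lq_seqs_nonneg)
  have "lq_fold q ?s n = lq_fold q (\<lambda>_. 0) n" by (rule lq_fold_cong) simp
  then have "g n = lq_fold q ?s (Suc n)" using q nn by (simp add: lq_fold_zero)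
  also have "\<dots> = lq_norm q ?s" using nn by (intro lq_norm_finite[symmetric]) auto
  also have "\<dots> \<le> lq_norm q g" using assms nn by (intro lq_norm_mono) auto
  finally show ?thesis .
qed

lemma lq_norm_insert:
  assumes g: "g \<in> lq_seqs q" "g k = lq_add q a b" "0 \<le> a" "0 \<le> b"
  shows "lq_norm q g = lq_add q (lq_norm q (g(k := a))) b"
proof (rule LIMSEQ_unique[OF lq_fold_tendsto[OF q g(1)]])
  have nn: "0 \<le> g n" for n using g(1) by (rule lq_seqs_nonneg)
  have "a \<le> g k" using q g by (simp add: lq_add_ge_left)
  then have g': "g(k := a) \<in> lq_seqs q" using g(3) nn by (intro lq_seqs_mono[OF q g(1)]) auto
  have "(\<lambda>n. lq_add q (lq_fold q (g(k := a)) n) b) \<longlonglongrightarrow> lq_add q (lq_norm q (g(k := a))) b"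
    using g(4) g' lq_seqs_nonneg[OF g']
    by (intro tendsto_lq_add q lq_fold_tendsto tendsto_const lq_fold_nonneg lq_norm_nonneg)
  then show "lq_fold q g \<longlonglongrightarrow> lq_add q (lq_norm q (g(k := a))) b"
  proof (rule Lim_transform_eventually)
    show "\<forall>\<^sub>F n in sequentially. lq_add q (lq_fold q (g(k := a)) n) b = lq_fold q g n"
      using eventually_gt_at_top[of k]
      by eventually_elim (use lq_fold_insert[OF q, of g k a b] nn g in simp)
  qed
qed

lemma lq_norm_split:
  assumes g: "g \<in> lq_seqs q"
  shows "lq_norm q g
    = lq_add q (lq_norm q (\<lambda>m. if m < k then g m else 0)) (lq_norm q (\<lambda>m. if m < k then 0 else g m))"
proof (rule LIMSEQ_unique[OF lq_fold_tendsto[OF q g]])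
  let ?a = "\<lambda>m. if m < k then g m else 0" and ?b = "\<lambda>m. if m < k then 0 else g m"
  have nn: "0 \<le> g n" for n using g by (rule lq_seqs_nonneg)
  have "?a \<in> lq_seqs q" "?b \<in> lq_seqs q" by (rule lq_seqs_mono[OF q g]; simp add: nn)+
  then have "(\<lambda>n. lq_add q (lq_fold q ?a n) (lq_fold q ?b n)) \<longlonglongrightarrow> lq_add q (lq_norm q ?a) (lq_norm q ?b)"
    using nn by (intro tendsto_lq_add q lq_fold_tendsto lq_fold_nonneg lq_norm_nonneg) auto
  then show "lq_fold q g \<longlonglongrightarrow> lq_add q (lq_norm q ?a) (lq_norm q ?b)"
    by (simp only: lq_fold_split[OF q nn, where k = k, symmetric])
qed

text \<open>For infinite \<open>q\<close> the tails of a null sequence have small supremum. For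
  finite \<open>q\<close>, \<open>lq_norm_split\<close> makes the r-th power of the tail norm the
  difference between the r-th powers of the full norm and of the fold, which converges to
  it.\<close>

lemma lq_norm_tail_tendsto:
  assumes g: "g \<in> lq_seqs q"
  shows "(\<lambda>k. lq_norm q (\<lambda>m. if m < k then 0 else g m)) \<longlonglongrightarrow> 0"
proof -
  have nn: "0 \<le> g n" for n using g by (rule lq_seqs_nonneg)
  let ?b = "\<lambda>k m. if m < k then 0 else g m"
  have b: "?b k \<in> lq_seqs q" for k by (rule lq_seqs_mono[OF q g]) (simp_all add: nn)
  from q show ?thesis
  proof (cases rule: ereal_ge_1_cases)
    case infinite
    show ?thesis
    proof (rule LIMSEQ_I)
      fix e :: real assume e: "0 < e"
      have "g \<longlonglongrightarrow> 0" using g infinite by (simp add: lq_seqs_def)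
      from LIMSEQ_D[OF this, of "e / 2"] e
      obtain K where K: "\<And>n. K \<le> n \<Longrightarrow> norm (g n - 0) < e / 2" by auto
      have "norm (lq_norm q (?b k) - 0) < e" if "K \<le> k" for k
      proof -
        have "lq_norm q (?b k) = (SUP m. ?b k m)" using infinite by (simp add: lq_norm_def)
        also have "\<dots> \<le> e / 2"
        proof (rule cSUP_least)
          fix m show "?b k m \<le> e / 2" using K[of m] nn[of m] that e by auto
        qed simp
        finally show ?thesis using lq_norm_nonneg[OF b, of k] e by simp
      qed
      then show "\<exists>K. \<forall>k\<ge>K. norm (lq_norm q (?b k) - 0) < e" by blast
    qed
  next
    case (real r)
    have eq: "lq_norm q (?b k) powr r = lq_norm q g powr r - lq_fold q g k powr r" for k
    proof -
      have "lq_norm q (\<lambda>m. if m < k then g m else 0) = lq_fold q (\<lambda>m. if m < k then g m else 0) k"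
        using nn by (intro lq_norm_finite) auto
      also have "\<dots> = lq_fold q g k" by (rule lq_fold_cong) simp
      finally show ?thesis
        using lq_norm_split[OF g, of k] real by (simp add: lq_add_powr)
    qed
    have "(\<lambda>k. lq_norm q g powr r - lq_fold q g k powr r) \<longlonglongrightarrow> lq_norm q g powr r - lq_norm q g powr r"
      using real nn lq_fold_nonneg[of g q]
      by (intro tendsto_diff tendsto_const tendsto_powr' lq_fold_tendsto[OF q g]) auto
    then have "(\<lambda>k. lq_norm q (?b k) powr r) \<longlonglongrightarrow> 0" unfolding eq by simp
    then have "(\<lambda>k. (lq_norm q (?b k) powr r) powr (1 / r)) \<longlonglongrightarrow> 0 powr (1 / r)"
      using real by (intro tendsto_powr') auto
    then show ?thesis using lq_norm_nonneg[OF b] real by (simp add: powr_root_powr)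
  qed
qed

end

subsection \<open>Schauder bases isometric to the unit vector basis of \<open>\<ell>\<^sub>q\<close>\<close>

locale normed_subspace =
  fixes V :: "'a::real_vector set" and N :: "'a \<Rightarrow> real"
  assumes subspace_V: "subspace V"
    and N_nonneg: "v \<in> V \<Longrightarrow> 0 \<le> N v"
    and N_eq_0: "v \<in> V \<Longrightarrow> N v = 0 \<Longrightarrow> v = 0"
    and N_scaleR: "v \<in> V \<Longrightarrow> N (c *\<^sub>R v) = \<bar>c\<bar> * N v"
    and N_triangle: "u \<in> V \<Longrightarrow> v \<in> V \<Longrightarrow> N (u + v) \<le> N u + N v"
begin

lemma V_zero [simp]: "0 \<in> V"
  and V_add [intro, simp]: "u \<in> V \<Longrightarrow> v \<in> V \<Longrightarrow> u + v \<in> V"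
  and V_diff [intro, simp]: "u \<in> V \<Longrightarrow> v \<in> V \<Longrightarrow> u - v \<in> V"
  and V_scaleR [intro, simp]: "v \<in> V \<Longrightarrow> c *\<^sub>R v \<in> V"
  and V_minus [intro, simp]: "v \<in> V \<Longrightarrow> - v \<in> V"
  using subspace_V by (auto simp: subspace_0 subspace_add subspace_diff subspace_scale subspace_neg)

lemma V_sum [intro, simp]: "(\<And>i. i \<in> A \<Longrightarrow> g i \<in> V) \<Longrightarrow> sum g A \<in> V"
  using subspace_V by (rule subspace_sum)

lemma N_zero [simp]: "N 0 = 0"
  using N_scaleR[of 0 0] by simp

lemma N_minus: "v \<in> V \<Longrightarrow> N (- v) = N v"
  using N_scaleR[of v "-1"] by simp

lemma N_minus_commute: "u \<in> V \<Longrightarrow> v \<in> V \<Longrightarrow> N (u - v) = N (v - u)"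
  using N_minus[of "u - v"] by simp

lemma N_diff_triangle: "u \<in> V \<Longrightarrow> v \<in> V \<Longrightarrow> \<bar>N u - N v\<bar> \<le> N (u - v)"
  using N_triangle[of "u - v" v] N_triangle[of "v - u" u] N_minus_commute[of u v] by simp

lemma N_tendsto:
  assumes "\<And>n. s n \<in> V" "v \<in> V" "(\<lambda>n. N (v - s n)) \<longlonglongrightarrow> 0"
  shows "(\<lambda>n. N (s n)) \<longlonglongrightarrow> N v"
proof (rule LIM_zero_cancel, rule tendsto_0_le[OF assms(3), where K = 1], rule always_eventually, rule allI)
  show "norm (N (s n) - N v) \<le> norm (N (v - s n)) * 1" for n
    using N_diff_triangle[of "s n" v] N_minus_commute[of v "s n"] assms(1,2) by simp
qed

end

locale schauder_basis_space = normed_subspace V N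
  for V :: "'a::real_vector set" and N +
  fixes x :: "nat \<Rightarrow> 'a"
  assumes basis: "schauder_basis V N x"
begin

abbreviation coeff :: "'a \<Rightarrow> nat \<Rightarrow> real" where
  "coeff \<equiv> basis_coeff N x"

abbreviation lincomb :: "(nat \<Rightarrow> real) \<Rightarrow> nat set \<Rightarrow> 'a" where
  "lincomb a A \<equiv> \<Sum>i\<in>A. a i *\<^sub>R x i"

lemma basis_in [simp]: "x i \<in> V"
  using basis by (simp add: schauder_basis_def)

lemma lincomb_in [simp]: "lincomb a A \<in> V"
  by auto

lemma coeff_ex1: "v \<in> V \<Longrightarrow> \<exists>!a. (\<lambda>n. N (v - lincomb a {..<n})) \<longlonglongrightarrow> 0"
  using basis by (simp add: schauder_basis_def)

lemma coeff_tendsto: "v \<in> V \<Longrightarrow> (\<lambda>n. N (v - lincomb (coeff v) {..<n})) \<longlonglongrightarrow> 0"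
  unfolding basis_coeff_def by (rule theI'[OF coeff_ex1])

lemma coeff_unique:
  "v \<in> V \<Longrightarrow> (\<lambda>n. N (v - lincomb a {..<n})) \<longlonglongrightarrow> 0 \<Longrightarrow> coeff v = a"
  using coeff_ex1 coeff_tendsto by blast

lemma N_partial_sums_tendsto: "v \<in> V \<Longrightarrow> (\<lambda>n. N (lincomb (coeff v) {..<n})) \<longlonglongrightarrow> N v"
  by (rule N_tendsto) (auto intro: coeff_tendsto)

lemma coeff_add: assumes "u \<in> V" "v \<in> V" shows "coeff (u + v) = (\<lambda>i. coeff u i + coeff v i)"
proof (rule coeff_unique)
  have "(\<lambda>n. N (u - lincomb (coeff u) {..<n}) + N (v - lincomb (coeff v) {..<n})) \<longlonglongrightarrow> 0"
    using tendsto_add[OF coeff_tendsto coeff_tendsto] assms by force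
  then show "(\<lambda>n. N (u + v - lincomb (\<lambda>i. coeff u i + coeff v i) {..<n})) \<longlonglongrightarrow> 0"
  proof (rule tendsto_0_le[where K = 1], intro always_eventually allI)
    fix n
    have eq: "u + v - lincomb (\<lambda>i. coeff u i + coeff v i) {..<n}
        = (u - lincomb (coeff u) {..<n}) + (v - lincomb (coeff v) {..<n})"
      by (simp add: scaleR_add_left sum.distrib)
    show "norm (N (u + v - lincomb (\<lambda>i. coeff u i + coeff v i) {..<n}))
        \<le> norm (N (u - lincomb (coeff u) {..<n}) + N (v - lincomb (coeff v) {..<n})) * 1"
      unfolding eq
      using N_triangle[of "u - lincomb (coeff u) {..<n}" "v - lincomb (coeff v) {..<n}"]
        N_nonneg[of "(u - lincomb (coeff u) {..<n}) + (v - lincomb (coeff v) {..<n})"] assms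
      by (simp del: add_diff_eq)
  qed
qed (use assms in auto)

lemma coeff_scaleR: assumes "v \<in> V" shows "coeff (c *\<^sub>R v) = (\<lambda>i. c * coeff v i)"
proof (rule coeff_unique)
  have "c *\<^sub>R v - lincomb (\<lambda>i. c * coeff v i) {..<n} = c *\<^sub>R (v - lincomb (coeff v) {..<n})" for n
    by (simp add: scaleR_diff_right scaleR_sum_right)
  then show "(\<lambda>n. N (c *\<^sub>R v - lincomb (\<lambda>i. c * coeff v i) {..<n})) \<longlonglongrightarrow> 0"
    using tendsto_mult_right_zero[OF coeff_tendsto[OF assms], of "\<bar>c\<bar>"] assms by (simp add: N_scaleR)
qed (use assms in auto)

lemma coeff_minus: "v \<in> V \<Longrightarrow> coeff (- v) = (\<lambda>i. - coeff v i)"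
  using coeff_scaleR[of v "-1"] by simp

lemma coeff_diff: "u \<in> V \<Longrightarrow> v \<in> V \<Longrightarrow> coeff (u - v) = (\<lambda>i. coeff u i - coeff v i)"
  using coeff_add[of u "- v"] by (simp add: coeff_minus)

lemma coeff_lincomb:
  assumes "finite A"
  shows "coeff (lincomb a A) = (\<lambda>i. if i \<in> A then a i else 0)"
proof (rule coeff_unique)
  obtain m where m: "A \<subseteq> {..<m}" using assms finite_nat_iff_bounded by blast
  have "lincomb (\<lambda>i. if i \<in> A then a i else 0) {..<n} = lincomb a A" if "m \<le> n" for n
  proof (rule sum.mono_neutral_cong_right)
    show "A \<subseteq> {..<n}" using m that by auto
  qed auto
  then show "(\<lambda>n. N (lincomb a A - lincomb (\<lambda>i. if i \<in> A then a i else 0) {..<n})) \<longlonglongrightarrow> 0"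
    by (intro tendsto_eventually eventually_sequentiallyI[of m]) simp
qed simp

lemma coeff_basis: "coeff (x i) = (\<lambda>k. if k = i then 1 else 0)"
  using coeff_lincomb[of "{i}" "\<lambda>_. 1"] by (simp add: fun_eq_iff)

lemma coeff_zero: "coeff 0 = (\<lambda>_. 0)"
  using coeff_lincomb[of "{}"] by simp

lemma coeff_eq_zero: assumes "v \<in> V" "\<And>i. coeff v i = 0" shows "v = 0"
proof -
  have "(\<lambda>n. N v) \<longlonglongrightarrow> 0" using coeff_tendsto[OF assms(1)] assms(2) by simp
  then have "N v = 0" by (simp add: LIMSEQ_const_iff)
  with assms(1) show ?thesis by (rule N_eq_0)
qed

lemmas coeff_simps = coeff_add coeff_diff coeff_scaleR coeff_minus coeff_basis coeff_zero

lemma basis_nonzero: "x i \<noteq> 0"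
proof
  assume "x i = 0"
  then have "coeff 0 i = 1" using coeff_basis[of i] by simp
  then show False by (simp add: coeff_zero)
qed

lemma N_basis_pos: "0 < N (x i)"
  using N_nonneg[of "x i"] N_eq_0[of "x i"] basis_nonzero[of i] by fastforce

end

text \<open>The last assumption determines the norm of every finite combination, so up to the factor
  \<open>l\<close> the basis behaves like the unit vectors of \<open>\<ell>\<^sub>q\<close>
  (\<open>c\<^sub>0\<close> for infinite \<open>q\<close>). The locale serves both directions: it
  follows from 1-greediness, and for p = q it is verified for the unit vectors.\<close>

locale lq_basis = schauder_basis_space V N x
  for V :: "'a::real_vector set" and N x +
  fixes q :: ereal and l :: real
  assumes q: "1 \<le> q" and l_pos: "0 < l"
    and N_add_basis: "w \<in> V \<Longrightarrow> coeff w i = 0 \<Longrightarrow> N (w + s *\<^sub>R x i) = lq_add q (N w) (\<bar>s\<bar> * l)"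
begin

lemma N_scaleR_basis: "N (s *\<^sub>R x i) = \<bar>s\<bar> * l"
  using N_add_basis[of 0 i s] q l_pos by (simp add: coeff_zero)

lemma N_basis: "N (x i) = l"
  using N_scaleR_basis[of 1 i] by simp

lemma N_add_lincomb:
  assumes "finite A" "w \<in> V" "\<And>i. i \<in> A \<Longrightarrow> coeff w i = 0"
  shows "N (w + lincomb a A) = lq_add q (N w) (N (lincomb a A))"
  using assms(1,3)
proof (induction A)
  case empty
  then show ?case using q assms(2) by (simp add: N_nonneg)
next
  case (insert i A)
  have "N (w + lincomb a (insert i A)) = N ((w + lincomb a A) + a i *\<^sub>R x i)"
    using insert.hyps by (simp add: add_ac)
  also have "\<dots> = lq_add q (N (w + lincomb a A)) (\<bar>a i\<bar> * l)"
    using insert assms(2) by (intro N_add_basis) (auto simp: coeff_add coeff_lincomb)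
  also have "\<dots> = lq_add q (N w) (lq_add q (N (lincomb a A)) (\<bar>a i\<bar> * l))"
    using insert q by (simp add: lq_add_assoc)
  also have "lq_add q (N (lincomb a A)) (\<bar>a i\<bar> * l) = N (lincomb a A + a i *\<^sub>R x i)"
    using insert by (intro N_add_basis[symmetric]) (auto simp: coeff_lincomb)
  also have "lincomb a A + a i *\<^sub>R x i = lincomb a (insert i A)"
    using insert.hyps by (simp add: add_ac)
  finally show ?case .
qed

text \<open>The bound depends on \<open>A\<close> only through its cardinality. Together with the
  matching lower bound that follows, it allows the comparison of two different index sets in
  \<open>one_greedy\<close>.\<close>

lemma N_add_lincomb_le:
  assumes "finite A" "w \<in> V" "\<And>i. i \<in> A \<Longrightarrow> coeff w i = 0" "\<And>i. i \<in> A \<Longrightarrow> \<bar>a i\<bar> \<le> t"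
  shows "N (w + lincomb a A) \<le> ((\<lambda>y. lq_add q y (t * l)) ^^ card A) (N w)"
  using assms(1,3,4)
proof (induction A)
  case (insert i A)
  have "N (w + lincomb a (insert i A)) = N ((w + lincomb a A) + a i *\<^sub>R x i)"
    using insert.hyps by (simp add: add_ac)
  also have "\<dots> = lq_add q (N (w + lincomb a A)) (\<bar>a i\<bar> * l)"
    using insert assms(2) by (intro N_add_basis) (auto simp: coeff_add coeff_lincomb)
  also have "\<dots> \<le> lq_add q (((\<lambda>y. lq_add q y (t * l)) ^^ card A) (N w)) (t * l)"
    using insert q l_pos assms(2) by (intro lq_add_mono) (auto simp: N_nonneg)
  finally show ?case using insert.hyps by simp
qed simp

lemma N_add_lincomb_ge:
  assumes "finite A" "w \<in> V" "\<And>i. i \<in> A \<Longrightarrow> coeff w i = 0" "\<And>i. i \<in> A \<Longrightarrow> t \<le> \<bar>a i\<bar>" "0 \<le> t"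
  shows "((\<lambda>y. lq_add q y (t * l)) ^^ card A) (N w) \<le> N (w + lincomb a A)"
  using assms(1,3,4)
proof (induction A)
  case (insert i A)
  have nn: "0 \<le> ((\<lambda>y. lq_add q y (t * l)) ^^ k) (N w)" for k
    using l_pos assms(2,5) by (induction k) (auto intro: lq_add_nonneg simp: N_nonneg)
  have "((\<lambda>y. lq_add q y (t * l)) ^^ card (insert i A)) (N w)
      = lq_add q (((\<lambda>y. lq_add q y (t * l)) ^^ card A) (N w)) (t * l)"
    using insert.hyps by simp
  also have "\<dots> \<le> lq_add q (N (w + lincomb a A)) (\<bar>a i\<bar> * l)"
    using insert q l_pos assms(2,5) nn by (intro lq_add_mono) auto
  also have "\<dots> = N ((w + lincomb a A) + a i *\<^sub>R x i)"
    using insert assms(2) by (intro N_add_basis[symmetric]) (auto simp: coeff_add coeff_lincomb)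
  also have "(w + lincomb a A) + a i *\<^sub>R x i = w + lincomb a (insert i A)"
    using insert.hyps by (simp add: add_ac)
  finally show ?case .
qed simp

text \<open>Let \<open>w\<close> be the part of \<open>v\<close> outside \<open>A\<close> and
  \<open>B\<close>. The greedy remainder is \<open>w\<close> plus terms on B - A of modulus at most
  \<open>t\<close>, the competitor's remainder is \<open>w\<close> plus terms on A - B of modulus at
  least \<open>t\<close> and further terms on \<open>B\<close>. Since B - A has no more elements
  than A - B, and further disjoint terms never lower the norm, the greedy remainder is the smaller
  one.\<close>

theorem one_greedy: "one_greedy_basis V N x"
  unfolding greedy_basis_def
proof (intro conjI basis ballI allI impI)
  fix v n A
  assume v: "v \<in> V" and n: "1 \<le> n" and A: "largest_coeffs N x n v A"
  then have finA: "finite A" and cardA: "card A = n" by (auto simp: largest_coeffs_def)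
  then have "A \<noteq> {}" using n by auto
  define t where "t = Min ((\<lambda>i. \<bar>coeff v i\<bar>) ` A)"
  have t_le: "t \<le> \<bar>coeff v i\<bar>" if "i \<in> A" for i
    using that finA by (simp add: t_def)
  have t_ge: "\<bar>coeff v j\<bar> \<le> t" if "j \<notin> A" for j
    using that finA \<open>A \<noteq> {}\<close> A by (auto simp: t_def largest_coeffs_def)
  have t0: "0 \<le> t" using finA \<open>A \<noteq> {}\<close> by (simp add: t_def)
  have "N (v - greedy_approximant N x v A) \<le> N (v - lincomb a B)"
    if B: "finite B" "card B \<le> n" for a B
  proof -
    let ?h = "\<lambda>y. lq_add q y (t * l)"
    define w where "w = v - lincomb (coeff v) (A \<union> B)"
    have w: "w \<in> V" "\<And>i. i \<in> A \<union> B \<Longrightarrow> coeff w i = 0"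
      using v finA B by (auto simp: w_def coeff_diff coeff_lincomb)
    have card_le: "card (B - A) \<le> card (A - B)"
      using card_le_sym_Diff[of B A] B finA cardA by simp
    have "lincomb (coeff v) (A \<union> B) = lincomb (coeff v) A + lincomb (coeff v) (B - A)"
      using finA B(1) by (subst sum.union_disjoint[symmetric]) auto
    then have "v - greedy_approximant N x v A = w + lincomb (coeff v) (B - A)"
      by (simp add: w_def greedy_approximant_def)
    then have "N (v - greedy_approximant N x v A) \<le> (?h ^^ card (B - A)) (N w)"
      using B w by (simp, intro N_add_lincomb_le) (auto simp: t_ge)
    also have "\<dots> \<le> (?h ^^ card (A - B)) (N w)"
      using card_le
    proof (induction rule: dec_induct)
      case (step k)
      have "0 \<le> (?h ^^ k) (N w)"
        using l_pos t0 w by (induction k) (auto intro: lq_add_nonneg simp: N_nonneg)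
      then have "(?h ^^ k) (N w) \<le> (?h ^^ Suc k) (N w)"
        using l_pos t0 q by (auto intro: lq_add_ge_left)
      with step show ?case by simp
    qed simp
    also have "\<dots> \<le> N (w + lincomb (coeff v) (A - B))"
      using finA w t0 by (intro N_add_lincomb_ge) (auto simp: t_le)
    also have "\<dots> \<le> lq_add q (N (w + lincomb (coeff v) (A - B))) (N (lincomb (\<lambda>i. coeff v i - a i) B))"
      using w q by (intro lq_add_ge_left) (auto intro!: N_nonneg)
    also have "\<dots> = N (w + lincomb (coeff v) (A - B) + lincomb (\<lambda>i. coeff v i - a i) B)"
      using w finA B by (intro N_add_lincomb[symmetric]) (auto simp: coeff_add coeff_lincomb)
    also have "lincomb (coeff v) (A \<union> B) = lincomb (coeff v) (A - B) + lincomb (coeff v) B"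
      using finA B(1) by (subst sum.union_disjoint[symmetric]) auto
    then have "w + lincomb (coeff v) (A - B) + lincomb (\<lambda>i. coeff v i - a i) B = v - lincomb a B"
      by (simp add: w_def scaleR_diff_left sum_subtractf)
    finally show ?thesis .
  qed
  \<comment> \<open>The empty index set shows that the infimum is taken over a nonempty set.\<close>
  then show "N (v - greedy_approximant N x v A) \<le> 1 * best_nterm_error N x n v"
    unfolding best_nterm_error_def mult_1
    by (intro cInf_greatest) (auto intro: exI[of "\<lambda>A. finite A \<and> card A \<le> n" "{}"])
qed

end

subsection \<open>Isometric involutions\<close>

text \<open>Here \<open>u = u\<^sub>0 + a x\<^sub>i\<close> and \<open>v = - u\<^sub>0 + (1 - a) x\<^sub>i\<close> split the basis vector \<open>x\<^sub>i\<close>, and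
  \<open>U\<close>, \<open>W\<close>, \<open>C\<close> are the norms of \<open>u\<close>, \<open>v\<close>, \<open>u\<^sub>0\<close>. The hypothesis says that \<open>u\<close> and \<open>v\<close> are
  \<open>\<ell>\<^sub>q\<close>-orthogonal, the conclusion that one of them vanishes. For \<open>q < \<infinity>\<close>, the choice
  \<open>\<alpha> = 1 - a\<close>, \<open>\<beta> = - a\<close> gives \<open>\<bar>a\<bar>\<^bsup>q/2\<^esup> + \<bar>1 - a\<bar>\<^bsup>q/2\<^esup> = 1\<close>.\<close>

lemma lq_decomposition_trivial:
  fixes a U W C :: real
  assumes q: "1 \<le> q" "q \<noteq> 2" and nn: "0 \<le> U" "0 \<le> W" "0 \<le> C"
    and eq: "\<And>\<alpha> \<beta>. lq_add q (\<bar>\<alpha>\<bar> * U) (\<bar>\<beta>\<bar> * W) = lq_add q (\<bar>\<alpha> - \<beta>\<bar> * C) \<bar>\<alpha> * a + \<beta> * (1 - a)\<bar>"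
  shows "C = 0 \<and> (a = 0 \<or> a = 1)"
  using q(1)
proof (cases rule: ereal_ge_1_cases)
  case infinite
  note e = eq[unfolded infinite lq_add_infty]
  have U: "U = max C \<bar>a\<bar>" using e[of 1 0] nn by simp
  have W: "W = max C \<bar>1 - a\<bar>" using e[of 0 1] nn by simp
  have UW: "max U W = 1" using e[of 1 1] by simp
  \<comment> \<open>The test values (1, 1) and (1, -1) together confine \<open>a\<close> to [0, 1]
    and \<open>C\<close> to at most 1/2.\<close>
  have m: "max (2 * C) \<bar>a - (1 - a)\<bar> = 1" using e[of 1 "-1"] UW by simp
  then have a01: "0 \<le> a" "a \<le> 1" and C: "2 * C \<le> 1" by linarith+
  show ?thesis
  proof (cases "C = 0")
    case True
    then show ?thesis using U W UW a01 by (auto simp: max_def split: if_splits)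
  next
    case False
    then have "0 < C" using nn by simp
    from UW consider "U = 1" | "W = 1" by (auto simp: max_def split: if_splits)
    then show ?thesis
    proof cases
      case 1
      then have a: "a = 1" using U C a01 by (auto simp: max_def split: if_splits)
      then have "W = C" using W nn by simp
      \<comment> \<open>As U = 1 and W = C, the value -1/C for the second scalar makes both terms on
        the left equal to 1, while the right side is at least C + 1 > 1.\<close>
      then have "max 1 1 = max ((1 + 1 / C) * C) 1"
        using e[of 1 "- 1 / C"] 1 a \<open>0 < C\<close> by simp
      moreover have "(1 + 1 / C) * C = C + 1" using \<open>0 < C\<close> by (simp add: field_simps)
      ultimately show ?thesis using \<open>0 < C\<close> by (simp add: max_def split: if_splits)
    next
      case 2
      then have a: "a = 0" using W C a01 by (auto simp: max_def split: if_splits)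
      then have "U = C" using U nn by simp
      then have "max 1 1 = max ((1 + 1 / C) * C) 1"
        using e[of "- 1 / C" 1] 2 a \<open>0 < C\<close> by (simp add: abs_minus_commute)
      moreover have "(1 + 1 / C) * C = C + 1" using \<open>0 < C\<close> by (simp add: field_simps)
      ultimately show ?thesis using \<open>0 < C\<close> by (simp add: max_def split: if_splits)
    qed
  qed
next
  case (real r)
  define b where "b = 1 - a"
  define c where "c = C powr r"
  define s where "s = \<bar>a\<bar> powr r"
  define t where "t = \<bar>b\<bar> powr r"
  have e: "\<bar>\<alpha>\<bar> powr r * U powr r + \<bar>\<beta>\<bar> powr r * W powr r
      = \<bar>\<alpha> - \<beta>\<bar> powr r * c + \<bar>\<alpha> * a + \<beta> * b\<bar> powr r" for \<alpha> \<beta>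
    using arg_cong[OF eq[of \<alpha> \<beta>], of "\<lambda>z. z powr r"] real nn
    by (simp add: lq_add_powr powr_mult b_def c_def)
  have U: "U powr r = c + s" using e[of 1 0] by (simp add: s_def)
  have W: "W powr r = c + t" using e[of 0 1] by (simp add: t_def)
  have st: "s + t = 1 - 2 * c" using e[of 1 1] by (simp add: U W b_def)
  have "b * a + - a * b = 0" "\<bar>b - - a\<bar> = 1" by (simp_all add: b_def)
  then have "t * (c + s) + s * (c + t) = c"
    using e[of b "- a"] by (simp add: U W s_def t_def)
  then have "c * (s + t) + 2 * (s * t) = c" by (simp add: algebra_simps)
  then have prod: "s * t = c\<^sup>2" unfolding st by (simp add: algebra_simps power2_eq_square)
  \<comment> \<open>With the square roots of \<open>s\<close> and \<open>t\<close>, the relations st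
    = c^2 and s + t = 1 - 2c combine to (s' + t')^2 = 1.\<close>
  define s' where "s' = \<bar>a\<bar> powr (r / 2)"
  define t' where "t' = \<bar>b\<bar> powr (r / 2)"
  have sq: "s = s'\<^sup>2" "t = t'\<^sup>2"
    by (simp_all add: s_def t_def s'_def t'_def power2_eq_square flip: powr_add)
  have nn': "0 \<le> s'" "0 \<le> t'" "0 \<le> c" by (simp_all add: s'_def t'_def c_def)
  have "(s' * t')\<^sup>2 = c\<^sup>2" using prod sq by (simp add: power_mult_distrib)
  then have st': "s' * t' = c" using nn' by (simp add: power2_eq_iff_nonneg)
  have "(s' + t')\<^sup>2 = 1\<^sup>2" using st by (simp add: power2_sum sq st')
  then have sum1: "s' + t' = 1" using nn' by (subst (asm) power2_eq_iff_nonneg) auto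
  have le1: "\<bar>z\<bar> \<le> 1" if "\<bar>z\<bar> powr (r / 2) \<le> 1" for z
  proof (rule ccontr)
    assume "\<not> \<bar>z\<bar> \<le> 1"
    then have "1 < \<bar>z\<bar> powr (r / 2)" using real by (intro gr_one_powr) auto
    with that show False by simp
  qed
  have "\<bar>a\<bar> \<le> 1" "\<bar>b\<bar> \<le> 1" using le1[of a] le1[of b] sum1 nn'
    unfolding s'_def t'_def by linarith+
  then have a01: "0 \<le> a" "a \<le> 1" by (auto simp: b_def)
  \<comment> \<open>Here \<open>q \<noteq> 2\<close> enters: for 0 < a < 1 the sum a^(r/2) + (1 -
    a)^(r/2) lies strictly above a + (1 - a) = 1 if r < 2 and strictly below it if r > 2.\<close>
  have a: "a = 0 \<or> a = 1"
  proof (rule ccontr)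
    assume "\<not> (a = 0 \<or> a = 1)"
    then have ab: "0 < a" "a < 1" "0 < b" "b < 1" using a01 by (auto simp: b_def)
    have "r \<noteq> 2" using q real by auto
    then consider "r < 2" | "2 < r" by linarith
    then show False
    proof cases
      case 1
      then have "a powr 1 < a powr (r / 2)" "b powr 1 < b powr (r / 2)"
        using ab by (intro powr_less_mono'; simp)+
      then show False using sum1 ab by (simp add: s'_def t'_def b_def)
    next
      case 2
      then have "a powr (r / 2) < a powr 1" "b powr (r / 2) < b powr 1"
        using ab by (intro powr_less_mono'; simp)+
      then show False using sum1 ab by (simp add: s'_def t'_def b_def)
    qed
  qed
  then have "s' * t' = 0" by (auto simp: s'_def t'_def b_def)
  then have "C = 0" using st' by (simp add: c_def)
  with a show ?thesis by simp
qed

context lq_basis begin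

text \<open>Take \<open>j\<close> in the support of \<open>T (x i)\<close>, with coefficient
  \<open>b\<close>, and split off the term b x_j. Applying \<open>T\<close> again splits x_i into u
  + v. As \<open>T\<close> is isometric, \<open>u\<close> and \<open>v\<close> combine like a
  multiple of x_j and a vector without x_j, which is the orthogonality required by
  \<open>lq_decomposition_trivial\<close>. Hence \<open>u\<close> is 0 or x_i; it is not 0, so
  \<open>T (x i)\<close> is b x_j, and comparing norms gives modulus 1.\<close>

lemma involution_maps_basis:
  assumes q2: "q \<noteq> 2"
    and T_in: "\<And>v. v \<in> V \<Longrightarrow> T v \<in> V"
    and T_lin: "\<And>\<alpha> \<beta> u v. u \<in> V \<Longrightarrow> v \<in> V \<Longrightarrow> T (\<alpha> *\<^sub>R u + \<beta> *\<^sub>R v) = \<alpha> *\<^sub>R T u + \<beta> *\<^sub>R T v"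
    and T_T: "\<And>v. v \<in> V \<Longrightarrow> T (T v) = v"
    and T_N: "\<And>v. v \<in> V \<Longrightarrow> N (T v) = N v"
  obtains j b where "\<bar>b\<bar> = 1" "T (x i) = b *\<^sub>R x j"
proof -
  have T0: "T 0 = 0" using T_lin[of 0 0 0 0] by simp
  have Ts: "T (\<alpha> *\<^sub>R v) = \<alpha> *\<^sub>R T v" if "v \<in> V" for \<alpha> v
    using T_lin[of v v \<alpha> 0] that by simp
  have "\<exists>j. coeff (T (x i)) j \<noteq> 0"
  proof (rule ccontr)
    assume "\<not> ?thesis"
    then have "T (x i) = 0" using coeff_eq_zero[of "T (x i)"] T_in by auto
    then show False using T_T[of "x i"] T0 basis_nonzero by simp
  qed
  then obtain j where j: "coeff (T (x i)) j \<noteq> 0" by blast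
  define b where "b = coeff (T (x i)) j"
  define u where "u = b *\<^sub>R T (x j)"
  define a where "a = coeff u i"
  define u0 where "u0 = u - a *\<^sub>R x i"
  define v where "v = x i - u"
  have in_V: "u \<in> V" "u0 \<in> V" "v \<in> V" using T_in by (auto simp: u_def u0_def v_def)
  have u0i: "coeff u0 i = 0" using in_V by (simp add: u0_def coeff_simps a_def)
  have Tu: "T u = b *\<^sub>R x j" using T_in by (simp add: u_def Ts T_T)
  have Tv: "T v = T (x i) - b *\<^sub>R x j"
    using T_lin[of "x i" u 1 "-1"] in_V by (simp add: v_def Tu)
  have Tvj: "coeff (T v) j = 0" using T_in by (simp add: Tv coeff_simps b_def)
  have Nu: "N u = \<bar>b\<bar> * l" using T_N[OF in_V(1)] by (simp add: Tu N_scaleR_basis)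
  have "lq_add q (\<bar>\<alpha>\<bar> * (N u / l)) (\<bar>\<beta>\<bar> * (N v / l))
      = lq_add q (\<bar>\<alpha> - \<beta>\<bar> * (N u0 / l)) \<bar>\<alpha> * a + \<beta> * (1 - a)\<bar>" for \<alpha> \<beta>
  proof -
    have *: "\<alpha> *\<^sub>R u + \<beta> *\<^sub>R v = (\<alpha> - \<beta>) *\<^sub>R u0 + (\<alpha> * a + \<beta> * (1 - a)) *\<^sub>R x i"
      by (simp add: u0_def v_def algebra_simps)
    have "N (\<alpha> *\<^sub>R u + \<beta> *\<^sub>R v) = lq_add q (\<bar>\<alpha> - \<beta>\<bar> * N u0) (\<bar>\<alpha> * a + \<beta> * (1 - a)\<bar> * l)"
      unfolding * using in_V u0i by (subst N_add_basis) (auto simp: coeff_simps N_scaleR)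
    moreover have "N (\<alpha> *\<^sub>R u + \<beta> *\<^sub>R v) = N (\<beta> *\<^sub>R T v + (\<alpha> * b) *\<^sub>R x j)"
      using in_V T_N[of "\<alpha> *\<^sub>R u + \<beta> *\<^sub>R v"] by (simp add: T_lin Tu add.commute)
    moreover have "\<dots> = lq_add q (\<bar>\<beta>\<bar> * N v) (\<bar>\<alpha>\<bar> * N u)"
      using in_V T_in[OF in_V(3)] Tvj
      by (subst N_add_basis) (auto simp: coeff_simps N_scaleR T_N Nu abs_mult mult_ac)
    ultimately have "lq_add q (\<bar>\<alpha>\<bar> * N u) (\<bar>\<beta>\<bar> * N v)
        = lq_add q (\<bar>\<alpha> - \<beta>\<bar> * N u0) (\<bar>\<alpha> * a + \<beta> * (1 - a)\<bar> * l)"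
      by (simp add: lq_add_commute)
    then have "lq_add q (1 / l * (\<bar>\<alpha>\<bar> * N u)) (1 / l * (\<bar>\<beta>\<bar> * N v))
        = lq_add q (1 / l * (\<bar>\<alpha> - \<beta>\<bar> * N u0)) (1 / l * (\<bar>\<alpha> * a + \<beta> * (1 - a)\<bar> * l))"
      using q l_pos in_V by (subst (1 2) lq_add_mult) (auto simp: N_nonneg)
    then show ?thesis using l_pos by (simp add: mult_ac)
  qed
  then have "N u0 / l = 0 \<and> (a = 0 \<or> a = 1)"
    using q q2 l_pos in_V
    by (intro lq_decomposition_trivial[of q "N u / l" "N v / l"]) (auto simp: N_nonneg)
  then have "u0 = 0" "a = 0 \<or> a = 1" using l_pos in_V(2) N_eq_0 by auto
  then have u: "u = a *\<^sub>R x i" by (simp add: u0_def)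
  have "b \<noteq> 0" using j by (simp add: b_def)
  have "a \<noteq> 0"
  proof
    assume "a = 0"
    then have "u = 0" using u by simp
    then have "b *\<^sub>R x j = 0" using Tu T0 by simp
    then show False using \<open>b \<noteq> 0\<close> basis_nonzero by simp
  qed
  then have "u = x i" using u \<open>a = 0 \<or> a = 1\<close> by auto
  then have "T (x i) = b *\<^sub>R x j" "\<bar>b\<bar> = 1" using Tu Nu l_pos N_basis[of i] by auto
  then show thesis using that by blast
qed

text \<open>The map v - 2 f(v) e is the isometric reflection that fixes the kernel of
  \<open>f\<close> and sends \<open>e\<close> to its negative. The bound on \<open>f\<close>
  supplies continuity.\<close>

definition reflection :: "'a \<Rightarrow> ('a \<Rightarrow> real) \<Rightarrow> bool" where
  "reflection e f \<longleftrightarrow> e \<in> V \<and> f e = 1 \<and>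
     (\<forall>v\<in>V. \<bar>f v\<bar> \<le> N v \<and> N (v - (2 * f v) *\<^sub>R e) = N v) \<and>
     (\<forall>u\<in>V. \<forall>v\<in>V. \<forall>\<alpha> \<beta>. f (\<alpha> *\<^sub>R u + \<beta> *\<^sub>R v) = \<alpha> * f u + \<beta> * f v)"

lemma reflectionD:
  assumes "reflection e f"
  shows "e \<in> V" "f e = 1" "v \<in> V \<Longrightarrow> \<bar>f v\<bar> \<le> N v" "v \<in> V \<Longrightarrow> N (v - (2 * f v) *\<^sub>R e) = N v"
    "u \<in> V \<Longrightarrow> v \<in> V \<Longrightarrow> f (\<alpha> *\<^sub>R u + \<beta> *\<^sub>R v) = \<alpha> * f u + \<beta> * f v"
    "v \<in> V \<Longrightarrow> f (\<alpha> *\<^sub>R v) = \<alpha> * f v"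
    "u \<in> V \<Longrightarrow> v \<in> V \<Longrightarrow> f (u - v) = f u - f v"
proof -
  show lin: "f (\<alpha> *\<^sub>R u + \<beta> *\<^sub>R v) = \<alpha> * f u + \<beta> * f v" if "u \<in> V" "v \<in> V" for u v \<alpha> \<beta>
    using assms that by (auto simp: reflection_def)
  show "v \<in> V \<Longrightarrow> f (\<alpha> *\<^sub>R v) = \<alpha> * f v" using lin[of v v \<alpha> 0] by simp
  show "u \<in> V \<Longrightarrow> v \<in> V \<Longrightarrow> f (u - v) = f u - f v" using lin[of u v 1 "-1"] by simp
qed (use assms in \<open>auto simp: reflection_def\<close>)

text \<open>The reflection maps some x_i with f(x_i) nonzero to b x_j, so 2 f(x_i) e = x_i - b x_j.
  The case i = j is included: then b = -1 and \<open>e\<close> is a multiple of x_i. The symmetry of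
  the matrix of \<open>T\<close> makes \<open>f\<close> proportional to the coefficients of
  \<open>e\<close>.\<close>

lemma reflection_structure:
  assumes q2: "q \<noteq> 2" and ref: "reflection e f"
  obtains i j b \<mu> \<gamma> where "b = 1 \<or> b = -1" "\<mu> \<noteq> 0" "\<gamma> \<noteq> 0"
    "e = \<mu> *\<^sub>R (x i - b *\<^sub>R x j)" "\<And>k. f (x k) = \<gamma> * coeff e k"
proof -
  note f = reflectionD[OF ref]
  define T where "T v = v - (2 * f v) *\<^sub>R e" for v
  have T_in: "T v \<in> V" if "v \<in> V" for v using that f(1) by (simp add: T_def)
  have T_lin: "T (\<alpha> *\<^sub>R u + \<beta> *\<^sub>R v) = \<alpha> *\<^sub>R T u + \<beta> *\<^sub>R T v" if "u \<in> V" "v \<in> V" for \<alpha> \<beta> u v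
    using f(5)[OF that, of \<alpha> \<beta>] by (simp add: T_def algebra_simps)
  have T_T: "T (T v) = v" if "v \<in> V" for v
  proof -
    have "f (T v) = - f v" using that f(1,2) by (simp add: T_def f(6,7))
    then show ?thesis by (simp add: T_def[of "T v"]) (simp add: T_def)
  qed
  have T_N: "N (T v) = N v" if "v \<in> V" for v using f(4)[OF that] by (simp add: T_def)
  have T_basis: "\<exists>j b. \<bar>b\<bar> = 1 \<and> T (x i) = b *\<^sub>R x j" for i
    by (rule involution_maps_basis[of T i, OF q2 T_in T_lin T_T T_N]) auto
  \<comment> \<open>a signed permutation that is an involution is a symmetric matrix\<close>
  have sym: "coeff (T (x k)) m = coeff (T (x m)) k" for k m
  proof -
    obtain j b where j: "\<bar>b\<bar> = 1" "T (x k) = b *\<^sub>R x j" using T_basis by blast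
    obtain i c where i: "\<bar>c\<bar> = 1" "T (x m) = c *\<^sub>R x i" using T_basis by blast
    have swap: "coeff (T (x n')) n = b'" if "\<bar>b'\<bar> = 1" "T (x n) = b' *\<^sub>R x n'" for n n' b'
    proof -
      have "x n = b' *\<^sub>R T (x n')"
        using T_T[of "x n"] T_lin[of "x n'" "x n'" b' 0] that by simp
      then have "b' *\<^sub>R x n = (b' * b') *\<^sub>R T (x n')" by simp
      moreover have "b' * b' = 1" using that(1) by (auto simp: abs_if split: if_splits)
      ultimately have "T (x n') = b' *\<^sub>R x n" by simp
      then show ?thesis by (simp add: coeff_simps)
    qed
    consider "m = j" | "k = i" | "m \<noteq> j" "k \<noteq> i" by blast
    then show ?thesis
    proof cases
      case 1
      have "coeff (T (x k)) j = b" by (simp add: j(2) coeff_simps)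
      then show ?thesis using swap[OF j] 1 by simp
    next
      case 2
      have "coeff (T (x m)) i = c" by (simp add: i(2) coeff_simps)
      then show ?thesis using swap[OF i] 2 by simp
    next
      case 3
      then show ?thesis by (simp add: i(2) j(2) coeff_simps)
    qed
  qed
  \<comment> \<open>Off the diagonal, the entry of \<open>T\<close> in column k and row m is -2
    f(x_k) times the m-th coefficient of \<open>e\<close>.\<close>
  have fsym: "f (x k) * coeff e m = f (x m) * coeff e k" for k m
  proof (cases "k = m")
    case False
    then show ?thesis using sym[of k m] f(1) by (simp add: T_def coeff_diff coeff_scaleR coeff_basis)
  qed simp
  \<comment> \<open>If \<open>f\<close> vanished on the basis, it would vanish on all partial sums
    of \<open>e\<close> and, by its bound, at \<open>e\<close> itself, against f(e) = 1.\<close>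
  have "\<exists>i. f (x i) \<noteq> 0"
  proof (rule ccontr)
    assume "\<not> ?thesis"
    then have z: "f (x i) = 0" for i by blast
    have fl: "f (lincomb (coeff e) {..<n}) = 0" for n
    proof (induction n)
      case 0
      then show ?case using f(6)[of 0 0] by simp
    next
      case (Suc n)
      then show ?case using f(5)[of "lincomb (coeff e) {..<n}" "x n" 1 "coeff e n"] z by simp
    qed
    have "1 \<le> N (e - lincomb (coeff e) {..<n})" for n
      using f(3)[of "e - lincomb (coeff e) {..<n}"] f(1,2) fl[of n] by (simp add: f(7))
    then have "1 \<le> (0::real)"
      using LIMSEQ_le_const[OF coeff_tendsto[OF f(1)], of 1] by blast
    then show False by simp
  qed
  then obtain i where i: "f (x i) \<noteq> 0" by blast
  have "e \<noteq> 0" using f(2) f(6)[of 0 0] by auto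
  then obtain m where m: "coeff e m \<noteq> 0" using coeff_eq_zero f(1) by blast
  define \<gamma> where "\<gamma> = f (x m) / coeff e m"
  have fx: "f (x k) = \<gamma> * coeff e k" for k
    using fsym[of k m] m by (simp add: \<gamma>_def field_simps)
  obtain j b where j: "\<bar>b\<bar> = 1" "T (x i) = b *\<^sub>R x j" using T_basis by blast
  have "(2 * f (x i)) *\<^sub>R e = x i - b *\<^sub>R x j"
    using j(2) by (simp add: T_def algebra_simps)
  then have "(1 / (2 * f (x i))) *\<^sub>R ((2 * f (x i)) *\<^sub>R e) = (1 / (2 * f (x i))) *\<^sub>R (x i - b *\<^sub>R x j)"
    by simp
  then have e: "e = (1 / (2 * f (x i))) *\<^sub>R (x i - b *\<^sub>R x j)" using i by simp
  show thesis
  proof (rule that[OF _ _ _ e fx])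
    show "b = 1 \<or> b = -1" using j(1) by (auto simp: abs_if split: if_splits)
    show "1 / (2 * f (x i)) \<noteq> 0" using i by simp
    show "\<gamma> \<noteq> 0" using fx[of i] i by auto
  qed
qed

text \<open>As \<open>f\<close> is proportional to the coefficients of \<open>e\<close>, the
  condition f(e') = 0 is ordinary orthogonality of coefficient vectors. The vector e' involves at
  most two basis vectors; if it meets the support of \<open>e\<close>, orthogonality forces it to
  have exactly the two-point support of \<open>e\<close>, with the opposite relative sign.\<close>

lemma overlapping_reflections:
  assumes q2: "q \<noteq> 2" and ref: "reflection e f" "reflection e' f'"
    and orth: "f e' = 0" and overlap: "coeff e m * coeff e' m \<noteq> 0"
    and e: "e = \<mu> *\<^sub>R (x i - b *\<^sub>R x j)" "b = 1 \<or> b = -1"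
  obtains \<nu> where "\<nu> \<noteq> 0" "e' = \<nu> *\<^sub>R (x i + b *\<^sub>R x j)"
proof -
  obtain \<gamma> where \<gamma>: "\<gamma> \<noteq> 0" "\<And>k. f (x k) = \<gamma> * coeff e k"
    using reflection_structure[OF q2 ref(1)] by metis
  obtain k n b' \<mu>' where e': "b' = 1 \<or> b' = -1" "\<mu>' \<noteq> 0" "e' = \<mu>' *\<^sub>R (x k - b' *\<^sub>R x n)"
    using reflection_structure[OF q2 ref(2)] by metis
  have ce: "coeff e s = \<mu> * ((if s = i then 1 else 0) - b * (if s = j then 1 else 0))" for s
    by (simp add: e coeff_simps)
  have ce': "coeff e' s = \<mu>' * ((if s = k then 1 else 0) - b' * (if s = n then 1 else 0))" for s
    by (simp add: e' coeff_simps)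
  have "f e' = \<mu>' * (f (x k) - b' * f (x n))"
    unfolding e' by (simp add: reflectionD(6,7)[OF ref(1)])
  then have kn: "coeff e k = b' * coeff e n"
    using orth \<gamma> e' by (auto simp: algebra_simps)
  have "m = k \<or> m = n" using overlap ce'[of m] by (auto split: if_splits)
  then have nz: "coeff e k \<noteq> 0" "coeff e n \<noteq> 0" using kn overlap e'(1) by auto
  have "k \<noteq> n"
  proof
    assume "k = n"
    then have "b' = -1 \<or> e' = 0" using e' by auto
    then show False using \<open>k = n\<close> kn nz overlap by (auto simp: coeff_zero)
  qed
  moreover have "k = i \<or> k = j" "n = i \<or> n = j" using nz ce by (auto split: if_splits)
  ultimately consider "k = i" "n = j" "i \<noteq> j" | "k = j" "n = i" "i \<noteq> j" by blast
  then show thesis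
  proof cases
    case 1
    then have "b' = - b" using kn nz ce e(2) e'(1) by auto
    then show thesis using that[of \<mu>'] e' 1 by simp
  next
    case 2
    then have "b' = - b" using kn nz ce e(2) e'(1) by auto
    then have "e' = (\<mu>' * b) *\<^sub>R (x i + b *\<^sub>R x j)" using e' e(2) 2 by (auto simp: algebra_simps)
    then show thesis using that[of "\<mu>' * b"] e' e(2) by auto
  qed
qed

text \<open>By \<open>reflection_structure\<close> the second vector is a combination of at most two
  basis vectors, so \<open>N_add_lincomb\<close> applies.\<close>

lemma disjoint_reflections:
  assumes q2: "q \<noteq> 2" and ref: "reflection e f" "reflection e' f'"
    and disj: "\<And>m. coeff e m * coeff e' m = 0"
  shows "N (e + e') = lq_add q (N e) (N e')"
proof -
  obtain k n b' \<mu>' where e': "e' = \<mu>' *\<^sub>R (x k - b' *\<^sub>R x n)"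
    using reflection_structure[OF q2 ref(2)] by metis
  define A where "A = {m. coeff e' m \<noteq> 0}"
  have "A \<subseteq> {k, n}" by (auto simp: A_def e' coeff_simps split: if_splits)
  then have fin: "finite A" by (rule finite_subset) simp
  have "e' - lincomb (coeff e') A = 0"
    by (rule coeff_eq_zero) (use fin reflectionD(1)[OF ref(2)] in \<open>auto simp: coeff_diff coeff_lincomb A_def\<close>)
  then have "e' = lincomb (coeff e') A" by simp
  moreover have "N (e + lincomb (coeff e') A) = lq_add q (N e) (N (lincomb (coeff e') A))"
    using disj reflectionD(1)[OF ref(1)] by (intro N_add_lincomb fin) (auto simp: A_def)
  ultimately show ?thesis by simp
qed

text \<open>If all pairs overlapped, \<open>e 1\<close> and \<open>e 2\<close> would both be
  multiples of the single vector x_i + b x_j associated with \<open>e 0\<close>, hence proportional,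
  and \<open>f 1\<close> could not vanish at \<open>e 2\<close>.\<close>

lemma three_reflections:
  assumes q2: "q \<noteq> 2" and ref: "\<And>k. k < 3 \<Longrightarrow> reflection (e k) (f k)"
    and orth: "\<And>k m. k < 3 \<Longrightarrow> m < 3 \<Longrightarrow> k \<noteq> m \<Longrightarrow> f k (e m) = 0"
  obtains k m :: nat where "k < 3" "m < 3" "k \<noteq> m" "N (e k + e m) = lq_add q (N (e k)) (N (e m))"
proof (rule ccontr)
  assume "\<not> thesis"
  note not_disjoint = that[THEN notE[OF this]]
  have "\<exists>s. coeff (e k) s * coeff (e m) s \<noteq> 0" if km: "k < 3" "m < 3" "k \<noteq> m" for k m
  proof (rule ccontr)
    assume "\<not> ?thesis"
    then have "N (e k + e m) = lq_add q (N (e k)) (N (e m))"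
      by (intro disjoint_reflections[OF q2 ref[OF km(1)] ref[OF km(2)]]) blast
    then show False using not_disjoint[OF km] by blast
  qed
  then obtain s where s: "\<And>k m. k < 3 \<Longrightarrow> m < 3 \<Longrightarrow> k \<noteq> m \<Longrightarrow> coeff (e k) (s k m) * coeff (e m) (s k m) \<noteq> 0"
    by metis
  obtain i j b \<mu> where e: "b = 1 \<or> b = -1" "e 0 = \<mu> *\<^sub>R (x i - b *\<^sub>R x j)"
    using reflection_structure[OF q2 ref[of 0]] by (metis zero_less_numeral)
  obtain \<nu> where \<nu>: "\<nu> \<noteq> 0" "e 1 = \<nu> *\<^sub>R (x i + b *\<^sub>R x j)"
    by (rule overlapping_reflections[OF q2 ref[of 0] ref[of 1] orth[of 0 1] s[of 0 1] e(2,1)]) auto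
  obtain \<nu>' where \<nu>': "\<nu>' \<noteq> 0" "e 2 = \<nu>' *\<^sub>R (x i + b *\<^sub>R x j)"
    by (rule overlapping_reflections[OF q2 ref[of 0] ref[of 2] orth[of 0 2] s[of 0 2] e(2,1)]) auto
  have "e 2 = (\<nu>' / \<nu>) *\<^sub>R e 1" using \<nu> \<nu>' by simp
  then have "f 1 (e 2) = \<nu>' / \<nu>" using reflectionD(1,2,6)[OF ref[of 1]] by simp
  then show False using orth[of 1 2] \<nu> \<nu>' by simp
qed

text \<open>On finite combinations the squared norm is a multiple of the sum of squared
  coefficients; partial sums carry the identity to the limit.\<close>

lemma parallelogram:
  assumes q2: "q = 2" and uv: "u \<in> V" "v \<in> V"
  shows "(N (u + v))\<^sup>2 + (N (u - v))\<^sup>2 = 2 * (N u)\<^sup>2 + 2 * (N v)\<^sup>2"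
proof -
  have add2: "(lq_add q a b)\<^sup>2 = a\<^sup>2 + b\<^sup>2" if "0 \<le> a" "0 \<le> b" for a b
    using lq_add_powr[of 2 a b] that q2 lq_add_nonneg[OF that, of 2]
    by (simp add: powr_numeral)
  have sq: "(N (lincomb a A))\<^sup>2 = (\<Sum>i\<in>A. (a i)\<^sup>2) * l\<^sup>2" if "finite A" for a A
    using that
  proof (induction A)
    case (insert i A)
    have "(N (lincomb a A + a i *\<^sub>R x i))\<^sup>2 = (N (lincomb a A))\<^sup>2 + (\<bar>a i\<bar> * l)\<^sup>2"
      using insert l_pos by (subst N_add_basis) (auto simp: coeff_lincomb add2 N_nonneg)
    then show ?case using insert by (simp add: add_ac algebra_simps power_mult_distrib)
  qed simp
  let ?s = "\<lambda>w n. N (lincomb (coeff w) {..<n})"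
  have "(?s (u + v) n)\<^sup>2 + (?s (u - v) n)\<^sup>2 = 2 * (?s u n)\<^sup>2 + 2 * (?s v n)\<^sup>2" for n
    unfolding sq[OF finite_lessThan] using uv
    by (simp add: coeff_add coeff_diff power2_sum power2_diff sum.distrib sum_subtractf algebra_simps)
  moreover have "(\<lambda>n. (?s (u + v) n)\<^sup>2 + (?s (u - v) n)\<^sup>2) \<longlonglongrightarrow> (N (u + v))\<^sup>2 + (N (u - v))\<^sup>2"
    using uv by (intro tendsto_add tendsto_power N_partial_sums_tendsto) auto
  moreover have "(\<lambda>n. 2 * (?s u n)\<^sup>2 + 2 * (?s v n)\<^sup>2) \<longlonglongrightarrow> 2 * (N u)\<^sup>2 + 2 * (N v)\<^sup>2"
    using uv by (intro tendsto_add tendsto_mult_left tendsto_power N_partial_sums_tendsto) auto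
  ultimately show ?thesis using LIMSEQ_unique by simp
qed

end

subsection \<open>1-greedy bases in \<open>\<ell>\<^sub>q\<close>-sums\<close>

text \<open>Bolzano-Weierstrass is applied once for each of the finitely many sequences; passing to
  a further subsequence keeps the limits already obtained.\<close>

lemma convergent_subsequence_finite:
  fixes g :: "'c \<Rightarrow> nat \<Rightarrow> real"
  assumes "finite C" "\<And>c. c \<in> C \<Longrightarrow> bounded (range (g c))"
  obtains r :: "nat \<Rightarrow> nat" where "strict_mono r" "\<And>c. c \<in> C \<Longrightarrow> convergent (g c \<circ> r)"
  using assms
proof (induction C arbitrary: thesis rule: finite_induct)
  case empty
  show ?case by (rule empty(1)[of id]) (auto simp: strict_mono_def)
next
  case (insert c C)
  obtain r :: "nat \<Rightarrow> nat" where r: "strict_mono r" "\<And>c. c \<in> C \<Longrightarrow> convergent (g c \<circ> r)"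
    using insert.IH insert.prems(2) by blast
  have "bounded (range (g c \<circ> r))"
    using insert.prems(2)[of c] by (rule bounded_subset) auto
  then obtain s :: "nat \<Rightarrow> nat" where s: "strict_mono s" "convergent ((g c \<circ> r) \<circ> s)"
    using bounded_imp_convergent_subsequence[of "g c \<circ> r"] by (auto simp: convergent_def)
  show ?case
  proof (rule insert.prems(1)[of "r \<circ> s"])
    show "strict_mono (r \<circ> s)" using r(1) s(1) by (rule strict_mono_o)
    fix c' assume "c' \<in> insert c C"
    then show "convergent (g c' \<circ> (r \<circ> s))"
      using s(2) convergent_subseq_convergent[OF r(2) s(1), of c'] by (auto simp: o_assoc)
  qed
qed

text \<open>\<open>P n\<close> is the projection onto the first \<open>n\<close> summands and \<open>f c\<close>, for \<open>c \<in> C n\<close>, are their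
  coordinate functionals.\<close>

locale lq_decomposition = normed_subspace V N
  for V :: "'a::real_vector set" and N +
  fixes q :: ereal and P :: "nat \<Rightarrow> 'a \<Rightarrow> 'a" and C :: "nat \<Rightarrow> 'c set" and f :: "'c \<Rightarrow> 'a \<Rightarrow> real"
  assumes q: "1 \<le> q"
    and P_in: "v \<in> V \<Longrightarrow> P n v \<in> V"
    and P_split: "u \<in> V \<Longrightarrow> v \<in> V \<Longrightarrow>
        N (P n u + (v - P n v)) = lq_add q (N (P n u)) (N (v - P n v))"
    and P_tendsto: "v \<in> V \<Longrightarrow> (\<lambda>n. N (v - P n v)) \<longlonglongrightarrow> 0"
    and f_le: "v \<in> V \<Longrightarrow> \<bar>f c v\<bar> \<le> N v"
    and f_linear: "u \<in> V \<Longrightarrow> v \<in> V \<Longrightarrow> f c (\<alpha> *\<^sub>R u + \<beta> *\<^sub>R v) = \<alpha> * f c u + \<beta> * f c v"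
    and finite_C: "finite (C n)"
    and P_le: "v \<in> V \<Longrightarrow> N (P n v) \<le> (\<Sum>c\<in>C n. \<bar>f c v\<bar>)"
begin

text \<open>Replacing \<open>u\<close> by its head and \<open>v\<close> by its tail makes the
  splitting exact. Each replacement is paid for twice, once in the norm of the sum and once in the
  Lipschitz bound for \<open>lq_add\<close>.\<close>

lemma almost_split:
  assumes "u \<in> V" "v \<in> V"
  shows "\<bar>N (u + v) - lq_add q (N u) (N v)\<bar> \<le> 2 * N (u - P n u) + 2 * N (P n v)"
proof -
  note in_V = assms P_in[OF assms(1), of n] P_in[OF assms(2), of n]
  have "\<bar>N (u + v) - N (P n u + (v - P n v))\<bar> \<le> N ((u + v) - (P n u + (v - P n v)))"
    using in_V by (intro N_diff_triangle) auto
  also have "(u + v) - (P n u + (v - P n v)) = (u - P n u) + P n v" by simp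
  also have "N \<dots> \<le> N (u - P n u) + N (P n v)" using in_V by (intro N_triangle) auto
  finally have 1: "\<bar>N (u + v) - lq_add q (N (P n u)) (N (v - P n v))\<bar> \<le> N (u - P n u) + N (P n v)"
    by (simp add: P_split[OF assms])
  have "\<bar>lq_add q (N u) (N v) - lq_add q (N (P n u)) (N (v - P n v))\<bar>
      \<le> \<bar>N u - N (P n u)\<bar> + \<bar>N v - N (v - P n v)\<bar>"
    using in_V q by (intro lq_add_lipschitz) (auto intro: N_nonneg)
  also have "\<bar>N u - N (P n u)\<bar> \<le> N (u - P n u)" using in_V by (intro N_diff_triangle) auto
  also have "\<bar>N v - N (v - P n v)\<bar> \<le> N (P n v)"
    using N_diff_triangle[of v "v - P n v"] in_V by simp
  finally show ?thesis using 1 by linarith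
qed

text \<open>The gliding hump: first \<open>n\<close> is chosen so that \<open>u\<close> nearly lives
  in the first \<open>n\<close> summands, then \<open>v\<close> almost vanishing there. Since
  \<open>b\<close> and \<open>c\<close> do not change with \<open>v\<close>, the approximate
  equality becomes exact.\<close>

lemma N_add_eq_of_small_head:
  assumes u: "u \<in> V"
    and small: "\<And>n \<epsilon>. 0 < \<epsilon> \<Longrightarrow> \<exists>v\<in>V. N v = b \<and> N (u + v) = c \<and> N (P n v) < \<epsilon>"
  shows "c = lq_add q (N u) b"
proof -
  have "\<bar>c - lq_add q (N u) b\<bar> \<le> 0 + \<epsilon>" if "0 < \<epsilon>" for \<epsilon>
  proof -
    have "\<forall>\<^sub>F n in sequentially. N (u - P n u) < \<epsilon> / 4"
      using P_tendsto[OF u] that by (intro order_tendstoD) auto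
    then obtain n where n: "N (u - P n u) < \<epsilon> / 4" by (auto simp: eventually_sequentially)
    have "0 < \<epsilon> / 4" using that by simp
    then obtain v where "v \<in> V" "N v = b" "N (u + v) = c" "N (P n v) < \<epsilon> / 4"
      using small[of "\<epsilon> / 4" n] by blast
    then show ?thesis using almost_split[OF u, of v n] n by simp
  qed
  then have "\<bar>c - lq_add q (N u) b\<bar> \<le> 0" by (rule field_le_epsilon)
  then show ?thesis by simp
qed

lemma f_sum:
  "finite A \<Longrightarrow> (\<And>i. i \<in> A \<Longrightarrow> g i \<in> V) \<Longrightarrow> f c (\<Sum>i\<in>A. a i *\<^sub>R g i) = (\<Sum>i\<in>A. a i * f c (g i))"
proof (induction A rule: finite_induct)
  case empty
  show ?case using f_linear[of 0 0 c 0 0] by simp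
next
  case (insert i A)
  then show ?case using f_linear[of "g i" "\<Sum>i\<in>A. a i *\<^sub>R g i" c "a i" 1] by simp
qed

end

locale one_greedy_in_lq_decomposition =
  lq_decomposition V N q P C f + schauder_basis_space V N x
  for V :: "'a::real_vector set" and N q P and C :: "nat \<Rightarrow> 'c set" and f x +
  assumes greedy: "one_greedy_basis V N x"
begin

text \<open>The form in which 1-greediness is used: the left side is the greedy remainder of
  \<open>lincomb a D\<close>, the right side the remainder for a competitor with at most as many
  terms.\<close>

lemma greedy_lincomb:
  assumes fin: "finite D" "finite B" and A: "A \<subseteq> D" "A \<noteq> {}"
    and ge: "\<And>i j. i \<in> A \<Longrightarrow> j \<in> D - A \<Longrightarrow> \<bar>a j\<bar> \<le> \<bar>a i\<bar>"
    and card: "card B \<le> card A"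
  shows "N (lincomb a (D - A)) \<le> N (lincomb a D - lincomb b B)"
proof -
  let ?v = "lincomb a D"
  have finA: "finite A" using A fin by (auto intro: finite_subset)
  have c: "coeff ?v = (\<lambda>i. if i \<in> D then a i else 0)" using fin(1) by (rule coeff_lincomb)
  have "largest_coeffs N x (card A) ?v A"
    unfolding largest_coeffs_def c using finA A ge by auto
  moreover have "1 \<le> card A" using A finA by (simp add: Suc_leI card_gt_0_iff)
  ultimately have "N (?v - greedy_approximant N x ?v A) \<le> best_nterm_error N x (card A) ?v"
    using greedy lincomb_in unfolding greedy_basis_def by force
  also have "\<dots> \<le> N (?v - lincomb b B)"
    unfolding best_nterm_error_def
  proof (rule cInf_lower)
    show "bdd_below {N (?v - lincomb a A') |a A'. finite A' \<and> card A' \<le> card A}"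
      by (rule bdd_belowI[of _ 0]) (auto intro!: N_nonneg)
  qed (use fin card in blast)
  also have "greedy_approximant N x ?v A = lincomb a A"
    unfolding greedy_approximant_def c using A by (intro sum.cong) auto
  also have "?v - lincomb a A = lincomb a (D - A)"
    using A fin by (simp add: sum_diff)
  finally show ?thesis .
qed

text \<open>In the combination over all three sets, \<open>F\<close> and \<open>F'\<close> carry
  coefficients of the same maximal modulus. Greediness covers every choice among ties, so removing
  \<open>F'\<close> is at least as good as removing \<open>F\<close>; by symmetry the two remainders
  have equal norm.\<close>

lemma swap:
  assumes fin: "finite D" "finite F" "finite F'"
    and disj: "D \<inter> F = {}" "D \<inter> F' = {}" "F \<inter> F' = {}" and card: "card F = card F'"
    and a: "\<And>k. k \<in> D \<Longrightarrow> \<bar>a k\<bar> \<le> t" and b: "\<And>k. k \<in> F \<Longrightarrow> \<bar>b k\<bar> = t" "\<And>k. k \<in> F' \<Longrightarrow> \<bar>b' k\<bar> = t"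
  shows "N (lincomb a D + lincomb b F) = N (lincomb a D + lincomb b' F')"
proof -
  have le: "N (lincomb a D + lincomb b F) \<le> N (lincomb a D + lincomb b' F')"
    if fin: "finite F" "finite F'"
      and disj: "D \<inter> F = {}" "D \<inter> F' = {}" "F \<inter> F' = {}" and card: "card F = card F'"
      and b: "\<And>k. k \<in> F \<Longrightarrow> \<bar>b k\<bar> = t" "\<And>k. k \<in> F' \<Longrightarrow> \<bar>b' k\<bar> = t"
    for F F' b b'
  proof (cases "F' = {}")
    case True
    then show ?thesis using card fin by simp
  next
    case False
    define d where "d k = (if k \<in> F then b k else if k \<in> F' then b' k else a k)" for k
    have "N (lincomb d (D \<union> F \<union> F' - F')) \<le> N (lincomb d (D \<union> F \<union> F') - lincomb b F)"
    proof (rule greedy_lincomb)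
      fix i j assume "i \<in> F'" "j \<in> D \<union> F \<union> F' - F'"
      then show "\<bar>d j\<bar> \<le> \<bar>d i\<bar>" using disj a b by (auto simp: d_def)
    qed (use fin \<open>finite D\<close> card False in auto)
    moreover have l: "lincomb d D = lincomb a D" "lincomb d F = lincomb b F" "lincomb d F' = lincomb b' F'"
      using disj by (auto simp: d_def intro!: sum.cong)
    moreover have "D \<union> F \<union> F' - F' = D \<union> F" using disj by auto
    moreover have "lincomb d (D \<union> F) = lincomb d D + lincomb d F"
      using fin \<open>finite D\<close> disj by (intro sum.union_disjoint) auto
    moreover have "lincomb d (D \<union> F \<union> F') = lincomb d (D \<union> F) + lincomb d F'"
      using fin \<open>finite D\<close> disj by (intro sum.union_disjoint) auto
    ultimately show ?thesis by (simp add: algebra_simps)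
  qed
  show ?thesis
    using le[of F F' b b'] le[of F' F b' b] assms by (force simp: Int_commute)
qed

lemma swap_single:
  assumes "finite D" "i \<notin> D" "j \<notin> D" "\<And>k. k \<in> D \<Longrightarrow> \<bar>a k\<bar> \<le> \<bar>s\<bar>"
  shows "N (lincomb a D + s *\<^sub>R x i) = N (lincomb a D + s *\<^sub>R x j)"
proof (cases "i = j")
  case False
  then show ?thesis
    using swap[of D "{i}" "{j}" a "\<bar>s\<bar>" "\<lambda>_. s" "\<lambda>_. s"] assms by simp
qed simp

lemma N_basis_const: "N (x i) = N (x j)"
  using swap_single[of "{}" i j _ 1] by simp

text \<open>All basis vectors have the same norm, so their coordinates in \<open>C n\<close> are
  bounded and converge along a subsequence. Consecutive terms far out in it differ little there and
  avoid \<open>F\<close>.\<close>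

lemma fresh_pair:
  assumes "finite F" "0 < \<epsilon>"
  obtains m m' where "m \<noteq> m'" "m \<notin> F" "m' \<notin> F"
    "(\<Sum>c\<in>C n. \<bar>f c (x m) - f c (x m')\<bar>) < \<epsilon>"
proof -
  have "bounded (range (\<lambda>i. f c (x i)))" for c
  proof (rule boundedI[of _ "N (x 0)"])
    fix y assume "y \<in> range (\<lambda>i. f c (x i))"
    then obtain i where "y = f c (x i)" by blast
    then show "norm y \<le> N (x 0)" using f_le[of "x i" c] N_basis_const[of i 0] by simp
  qed
  then obtain r :: "nat \<Rightarrow> nat" where r: "strict_mono r"
    "\<And>c. c \<in> C n \<Longrightarrow> convergent ((\<lambda>i. f c (x i)) \<circ> r)"
    using convergent_subsequence_finite[OF finite_C, of n "\<lambda>c i. f c (x i)"] by blast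
  have "(\<lambda>k. \<Sum>c\<in>C n. \<bar>f c (x (r k)) - f c (x (r (Suc k)))\<bar>) \<longlonglongrightarrow> (\<Sum>c\<in>C n. 0)"
  proof (rule tendsto_sum)
    fix c assume "c \<in> C n"
    then obtain L where L: "(\<lambda>k. f c (x (r k))) \<longlonglongrightarrow> L" using r(2) by (auto simp: convergent_def o_def)
    then have "(\<lambda>k. f c (x (r k)) - f c (x (r (Suc k)))) \<longlonglongrightarrow> L - L"
      by (intro tendsto_diff) (auto intro: LIMSEQ_Suc)
    then show "(\<lambda>k. \<bar>f c (x (r k)) - f c (x (r (Suc k)))\<bar>) \<longlonglongrightarrow> 0"
      by (intro tendsto_rabs_zero) simp
  qed
  then have "\<forall>\<^sub>F k in sequentially. (\<Sum>c\<in>C n. \<bar>f c (x (r k)) - f c (x (r (Suc k)))\<bar>) < \<epsilon>"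
    using assms(2) by (intro order_tendstoD) auto
  then obtain K where K: "\<And>k. K \<le> k \<Longrightarrow> (\<Sum>c\<in>C n. \<bar>f c (x (r k)) - f c (x (r (Suc k)))\<bar>) < \<epsilon>"
    by (auto simp: eventually_sequentially)
  obtain M where M: "F \<subseteq> {..<M}" using assms(1) finite_nat_iff_bounded by blast
  define k where "k = max K M"
  have rk: "i \<le> r i" for i using r(1) by (rule strict_mono_imp_increasing)
  have "r k \<notin> F" "r (Suc k) \<notin> F" using M rk[of k] rk[of "Suc k"] by (auto simp: k_def)
  moreover have "r k \<noteq> r (Suc k)" using r(1) by (auto dest: strict_monoD[of r k "Suc k"])
  ultimately show thesis using that K[of k] by (auto simp: k_def)
qed

text \<open>The indices 0 and 1 are representatives: by \<open>N_add_pair\<close> with empty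
  \<open>D\<close>, every two distinct basis vectors give this value, with any signs.\<close>

definition pair_norm :: real where "pair_norm = N (x 0 + x 1)"

text \<open>By \<open>swap\<close>, the pair can be moved to \<open>t (x\<^sub>m - x\<^bsub>m'\<^esub>)\<close>, which almost vanishes on the first
  \<open>n\<close> summands. Single basis vectors need not tend to zero coordinatewise a priori.\<close>

lemma N_add_pair:
  assumes D: "finite D" "i \<notin> D" "j \<notin> D" "i \<noteq> j"
    and a: "\<And>k. k \<in> D \<Longrightarrow> \<bar>a k\<bar> \<le> t" and s: "\<bar>s\<bar> = t" "\<bar>s'\<bar> = t"
  shows "N (lincomb a D + (s *\<^sub>R x i + s' *\<^sub>R x j)) = lq_add q (N (lincomb a D)) (t * pair_norm)"
proof (rule N_add_eq_of_small_head)
  have t: "0 \<le> t" using s(1) by auto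
  fix n and \<epsilon> :: real assume "0 < \<epsilon>"
  then have "0 < \<epsilon> / (t + 1)" using t by simp
  \<comment> \<open>Excluding i, j, 0 and 1 keeps the new pair disjoint from both pairs with which
    it will be swapped.\<close>
  have "finite (D \<union> {i, j, 0, 1})" using D by simp
  from fresh_pair[OF this \<open>0 < \<epsilon> / (t + 1)\<close>, of n] obtain m m' where m: "m \<noteq> m'" "m \<notin> D \<union> {i, j, 0, 1}" "m' \<notin> D \<union> {i, j, 0, 1}"
    "(\<Sum>c\<in>C n. \<bar>f c (x m) - f c (x m')\<bar>) < \<epsilon> / (t + 1)"
    by blast
  let ?v = "t *\<^sub>R x m - t *\<^sub>R x m'"
  define b where "b k = (if k = m then t else - t)" for k
  have b: "lincomb b {m, m'} = ?v" using m(1) by (simp add: b_def)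
  have "N ?v = t * pair_norm"
    using swap[of "{}" "{m, m'}" "{0, 1}" a t b "\<lambda>_. t"] m t
    unfolding b by (simp add: pair_norm_def b_def N_scaleR flip: scaleR_add_right)
  moreover have "N (lincomb a D + ?v) = N (lincomb a D + (s *\<^sub>R x i + s' *\<^sub>R x j))"
    using swap[of D "{m, m'}" "{i, j}" a t b "\<lambda>k. if k = i then s else s'"] m D a s t
    unfolding b by (simp add: b_def)
  moreover have "N (P n ?v) < \<epsilon>"
  proof -
    have "N (P n ?v) \<le> (\<Sum>c\<in>C n. \<bar>f c ?v\<bar>)" by (rule P_le) simp
    also have "\<dots> = t * (\<Sum>c\<in>C n. \<bar>f c (x m) - f c (x m')\<bar>)"
      using t f_linear[of "x m" "x m'" _ t "- t"]
      by (simp add: sum_distrib_left abs_mult flip: right_diff_distrib)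
    also have "\<dots> \<le> t * (\<epsilon> / (t + 1))" using m(4) t by (intro mult_left_mono) auto
    also have "\<dots> < \<epsilon>" using t \<open>0 < \<epsilon>\<close> by (simp add: field_simps)
    finally show ?thesis .
  qed
  ultimately show "\<exists>v\<in>V. N v = t * pair_norm
      \<and> N (lincomb a D + v) = N (lincomb a D + (s *\<^sub>R x i + s' *\<^sub>R x j)) \<and> N (P n v) < \<epsilon>"
    by (intro bexI[of _ ?v]) auto
qed simp

lemma N_even_sum:
  assumes "finite F" "card F = 2 * m" "\<And>k. k \<in> F \<Longrightarrow> \<bar>a k\<bar> = 1"
  shows "N (lincomb a F) = lq_fold q (\<lambda>_. pair_norm) m"
  using assms
proof (induction m arbitrary: F)
  case (Suc m)
  then obtain i where i: "i \<in> F" by fastforce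
  then have "card (F - {i}) = Suc (2 * m)" using Suc.prems by simp
  then have "F - {i} \<noteq> {}" by (metis card.empty Zero_not_Suc)
  then obtain j where j: "j \<in> F - {i}" by blast
  define D where "D = F - {i, j}"
  have D: "finite D" "card D = 2 * m" "F = insert i (insert j D)" "i \<notin> D" "j \<notin> D" "i \<noteq> j"
    using Suc.prems i j by (auto simp: D_def card_Diff_subset)
  have "lincomb a F = lincomb a D + (a i *\<^sub>R x i + a j *\<^sub>R x j)"
    unfolding D(3) using D by (simp add: add_ac)
  then have "N (lincomb a F) = lq_add q (N (lincomb a D)) (1 * pair_norm)"
    using D Suc.prems(3) by (simp only:, intro N_add_pair) auto
  also have "N (lincomb a D) = lq_fold q (\<lambda>_. pair_norm) m"
    using D Suc.prems(3) by (intro Suc.IH) auto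
  finally show ?case by simp
qed simp

text \<open>Otherwise the coordinates of 2m basis vectors outside \<open>F0\<close> would have total
  modulus at least 2m times \<epsilon>. With suitable signs each single coordinate contributes at
  most the norm of a signed sum of 2m basis vectors, which is o(m) for q > 1.\<close>

lemma small_basis_vector:
  assumes q1: "1 < q" and F0: "finite F0" and \<epsilon>: "0 < \<epsilon>"
  obtains i where "i \<notin> F0" "(\<Sum>c\<in>C n. \<bar>f c (x i)\<bar>) < \<epsilon>"
proof (rule ccontr)
  assume "\<not> thesis"
  then have ge: "\<epsilon> \<le> (\<Sum>c\<in>C n. \<bar>f c (x i)\<bar>)" if "i \<notin> F0" for i
    using that \<open>\<And>i. i \<notin> F0 \<Longrightarrow> (\<Sum>c\<in>C n. \<bar>f c (x i)\<bar>) < \<epsilon> \<Longrightarrow> thesis\<close> by force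
  let ?\<rho> = "lq_fold q (\<lambda>_. pair_norm)" and ?K = "real (card (C n))"
  have le: "2 * \<epsilon> \<le> ?K * (?\<rho> m / real m)" if "0 < m" for m
  proof -
    have "infinite (- F0)" using F0 by (simp add: Compl_eq_Diff_UNIV)
    then obtain F where F: "F \<subseteq> - F0" "finite F" "card F = 2 * m"
      using infinite_arbitrarily_large by blast
    have "real (2 * m) * \<epsilon> \<le> (\<Sum>i\<in>F. \<Sum>c\<in>C n. \<bar>f c (x i)\<bar>)"
      using sum_bounded_below[of F \<epsilon> "\<lambda>i. \<Sum>c\<in>C n. \<bar>f c (x i)\<bar>"] F ge by force
    also have "\<dots> = (\<Sum>c\<in>C n. \<Sum>i\<in>F. \<bar>f c (x i)\<bar>)" by (rule sum.swap)
    also have "\<dots> \<le> (\<Sum>c\<in>C n. ?\<rho> m)"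
    proof (rule sum_mono)
      fix c
      \<comment> \<open>These signs turn the sum of moduli into one value of \<open>f c\<close>.
        They vary with \<open>c\<close>, but \<open>N_even_sum\<close> gives the same norm for all
        signs.\<close>
      define a where "a i = (if 0 \<le> f c (x i) then 1 else - 1 :: real)" for i
      have "(\<Sum>i\<in>F. \<bar>f c (x i)\<bar>) = (\<Sum>i\<in>F. a i * f c (x i))"
        by (intro sum.cong) (auto simp: a_def)
      also have "\<dots> = f c (lincomb a F)" using F by (simp add: f_sum)
      also have "\<dots> \<le> N (lincomb a F)" using f_le[of "lincomb a F" c] by simp
      also have "\<dots> = ?\<rho> m" using F by (intro N_even_sum) (auto simp: a_def)
      finally show "(\<Sum>i\<in>F. \<bar>f c (x i)\<bar>) \<le> ?\<rho> m" .
    qed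
    finally show ?thesis using that by (simp add: field_simps)
  qed
  have "(\<lambda>m. ?K * (?\<rho> m / real m)) \<longlonglongrightarrow> 0"
    using q1 by (intro tendsto_mult_right_zero lq_fold_const_sublinear) (auto simp: pair_norm_def N_nonneg)
  then have "2 * \<epsilon> \<le> 0"
    by (rule LIMSEQ_le_const) (use le in \<open>auto intro!: exI[of _ 1]\<close>)
  with \<epsilon> show False by simp
qed

text \<open>For q > 1, x_i is swapped for a basis vector with small head and the gliding hump
  applies. For q = 1 the value of \<open>pair_norm\<close> is found first; adding a second term s
  x_j then gives the lower bound, and the triangle inequality the upper one.\<close>

lemma N_add_largest:
  assumes D: "finite D" "i \<notin> D" and a: "\<And>k. k \<in> D \<Longrightarrow> \<bar>a k\<bar> \<le> \<bar>s\<bar>"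
  shows "N (lincomb a D + s *\<^sub>R x i) = lq_add q (N (lincomb a D)) (\<bar>s\<bar> * N (x 0))"
proof (cases "q = 1")
  case True
  \<comment> \<open>averaging the three pairs out of \<open>x\<^sub>0, x\<^sub>1, x\<^sub>2\<close> forces \<open>pair_norm = 2 N (x 0)\<close>\<close>
  have triple: "N (x 0 + x 1 + x 2) = N (x 0) + pair_norm" and two: "N (x 0 + x 2) = pair_norm"
    and two': "N (x 1 + x 2) = pair_norm"
    using N_add_pair[of "{0}" 1 2 "\<lambda>_. 1" 1 1 1] N_add_pair[of "{}" 0 2 undefined 1 1 1]
      N_add_pair[of "{}" 1 2 undefined 1 1 1] True
    by (auto simp: add.assoc lq_add_1 N_nonneg pair_norm_def)
  have "2 * (N (x 0) + pair_norm) = N ((x 0 + x 1) + ((x 0 + x 2) + (x 1 + x 2)))"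
    using N_scaleR[of "x 0 + x 1 + x 2" 2] unfolding triple
    by (simp add: scaleR_2 add_ac)
  also have "\<dots> \<le> N (x 0 + x 1) + (N (x 0 + x 2) + N (x 1 + x 2))"
    by (intro order_trans[OF N_triangle] add_left_mono N_triangle) auto
  finally have ge2: "2 * N (x 0) \<le> pair_norm" 
    unfolding two two' pair_norm_def[symmetric] by (simp add: algebra_simps)
  obtain j where j: "j \<notin> insert i D" using D(1) ex_new_if_finite[OF infinite_UNIV_nat] by blast
  have "N (lincomb a D) + \<bar>s\<bar> * pair_norm = N (lincomb a D + (s *\<^sub>R x i + s *\<^sub>R x j))"
    using D j a True by (subst N_add_pair[where t = "\<bar>s\<bar>"]) (auto simp: lq_add_1 N_nonneg pair_norm_def)
  also have "\<dots> \<le> N (lincomb a D + s *\<^sub>R x i) + N (s *\<^sub>R x j)"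
    unfolding add.assoc[symmetric] by (intro N_triangle) auto
  also have "N (s *\<^sub>R x j) = \<bar>s\<bar> * N (x 0)" using N_basis_const[of j 0] by (simp add: N_scaleR)
  finally have "N (lincomb a D) + \<bar>s\<bar> * pair_norm \<le> N (lincomb a D + s *\<^sub>R x i) + \<bar>s\<bar> * N (x 0)" .
  moreover have "\<bar>s\<bar> * (2 * N (x 0)) \<le> \<bar>s\<bar> * pair_norm" using ge2 by (intro mult_left_mono) auto
  moreover have "N (lincomb a D + s *\<^sub>R x i) \<le> N (lincomb a D) + \<bar>s\<bar> * N (x 0)"
    using N_triangle[of "lincomb a D" "s *\<^sub>R x i"] N_basis_const[of i 0] by (simp add: N_scaleR)
  ultimately show ?thesis using True by (simp add: lq_add_1 N_nonneg)
next
  case False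
  then have q1: "1 < q" using q by simp
  show ?thesis
  proof (rule N_add_eq_of_small_head)
    fix n and \<epsilon> :: real assume "0 < \<epsilon>"
    then have "0 < \<epsilon> / (\<bar>s\<bar> + 1)" by simp
    then obtain j where j: "j \<notin> D" "(\<Sum>c\<in>C n. \<bar>f c (x j)\<bar>) < \<epsilon> / (\<bar>s\<bar> + 1)"
      using small_basis_vector[OF q1 D(1), of "\<epsilon> / (\<bar>s\<bar> + 1)" n] by blast
    have "N (P n (s *\<^sub>R x j)) \<le> (\<Sum>c\<in>C n. \<bar>f c (s *\<^sub>R x j)\<bar>)" by (rule P_le) simp
    also have "\<dots> = \<bar>s\<bar> * (\<Sum>c\<in>C n. \<bar>f c (x j)\<bar>)"
      using f_linear[of "x j" "x j" _ s 0] by (simp add: sum_distrib_left abs_mult)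
    also have "\<dots> \<le> \<bar>s\<bar> * (\<epsilon> / (\<bar>s\<bar> + 1))" using j(2) by (intro mult_left_mono) auto
    also have "\<dots> < \<epsilon>" using \<open>0 < \<epsilon>\<close> by (simp add: field_simps)
    finally have "N (P n (s *\<^sub>R x j)) < \<epsilon>" .
    moreover have "N (lincomb a D + s *\<^sub>R x j) = N (lincomb a D + s *\<^sub>R x i)"
      using D j a by (intro swap_single) auto
    moreover have "N (s *\<^sub>R x j) = \<bar>s\<bar> * N (x 0)" using N_basis_const[of j 0] by (simp add: N_scaleR)
    ultimately show "\<exists>v\<in>V. N v = \<bar>s\<bar> * N (x 0) \<and> N (lincomb a D + v) = N (lincomb a D + s *\<^sub>R x i)
        \<and> N (P n v) < \<epsilon>"
      by (intro bexI[of _ "s *\<^sub>R x j"]) auto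
  qed simp
qed

text \<open>If s x_i is not a largest term, a largest term a_j x_j of \<open>D\<close> is taken out
  and added last, which \<open>N_add_largest\<close> permits. The induction hypothesis handles the
  two smaller combinations, and \<open>lq_add\<close> allows the exchange of order.\<close>

lemma N_add_single:
  assumes "finite D" "i \<notin> D"
  shows "N (lincomb a D + s *\<^sub>R x i) = lq_add q (N (lincomb a D)) (\<bar>s\<bar> * N (x 0))"
  using assms
proof (induction "card D" arbitrary: D i s)
  case 0
  then show ?case by (intro N_add_largest) auto
next
  case (Suc n)
  show ?case
  proof (cases "\<forall>k\<in>D. \<bar>a k\<bar> \<le> \<bar>s\<bar>")
    case True
    then show ?thesis using Suc.prems by (intro N_add_largest) auto
  next
    case False
    then have "D \<noteq> {}" by auto
    then have "Max ((\<lambda>k. \<bar>a k\<bar>) ` D) \<in> (\<lambda>k. \<bar>a k\<bar>) ` D" using Suc.prems(1) by (intro Max_in) auto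
    then obtain j where j: "j \<in> D" "Max ((\<lambda>k. \<bar>a k\<bar>) ` D) = \<bar>a j\<bar>" by blast
    then have j_max: "\<And>k. k \<in> D \<Longrightarrow> \<bar>a k\<bar> \<le> \<bar>a j\<bar>"
      using Suc.prems(1) by (metis Max_ge finite_imageI imageI)
    with False have aj: "\<bar>s\<bar> \<le> \<bar>a j\<bar>" by fastforce
    define E where "E = D - {j}"
    have E: "finite E" "j \<notin> E" "i \<notin> E" "i \<noteq> j" "D = insert j E" "n = card E"
      using Suc.prems Suc.hyps(2) j by (auto simp: E_def)
    define a' where "a' = a(i := s)"
    have l: "lincomb a' (insert i E) = lincomb a E + s *\<^sub>R x i"
      using E by (simp add: a'_def add.commute) (intro sum.cong, auto)
    have "lincomb a D + s *\<^sub>R x i = lincomb a' (insert i E) + a j *\<^sub>R x j"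
      unfolding l using E by (simp add: add_ac)
    also have "N \<dots> = lq_add q (N (lincomb a' (insert i E))) (\<bar>a j\<bar> * N (x 0))"
      using E j_max aj by (intro N_add_largest) (auto simp: a'_def)
    also have "N (lincomb a' (insert i E)) = lq_add q (N (lincomb a E)) (\<bar>s\<bar> * N (x 0))"
      unfolding l using E by (intro Suc.hyps(1)) auto
    also have "lq_add q \<dots> (\<bar>a j\<bar> * N (x 0))
        = lq_add q (lq_add q (N (lincomb a E)) (\<bar>a j\<bar> * N (x 0))) (\<bar>s\<bar> * N (x 0))"
      using q by (rule lq_add_right_commute)
    also have "lq_add q (N (lincomb a E)) (\<bar>a j\<bar> * N (x 0)) = N (lincomb a E + a j *\<^sub>R x j)"
      using E by (intro Suc.hyps(1)[symmetric]) auto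
    also have "lincomb a E + a j *\<^sub>R x j = lincomb a D" using E by (simp add: add.commute)
    finally show ?thesis .
  qed
qed

theorem lq_basis: "lq_basis V N x q (N (x 0))"
proof
  fix w i s assume w: "w \<in> V" "coeff w i = 0"
  let ?S = "\<lambda>n. lincomb (coeff w) {..<n}"
  have N: "N (?S n + s *\<^sub>R x i) = lq_add q (N (?S n)) (\<bar>s\<bar> * N (x 0))" for n
  proof -
    have "?S n = lincomb (coeff w) ({..<n} - {i})"
      using w(2) by (intro sum.mono_neutral_right) auto
    then show ?thesis by (simp add: N_add_single)
  qed
  have "(\<lambda>n. N (?S n + s *\<^sub>R x i)) \<longlonglongrightarrow> N (w + s *\<^sub>R x i)"
    using coeff_tendsto[OF w(1)] w(1) by (intro N_tendsto) auto
  moreover have "(\<lambda>n. lq_add q (N (?S n)) (\<bar>s\<bar> * N (x 0))) \<longlonglongrightarrow> lq_add q (N w) (\<bar>s\<bar> * N (x 0))"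
    using w(1) q by (intro tendsto_lq_add N_partial_sums_tendsto tendsto_const) (auto simp: N_nonneg)
  ultimately show "N (w + s *\<^sub>R x i) = lq_add q (N w) (\<bar>s\<bar> * N (x 0))"
    unfolding N by (rule LIMSEQ_unique)
qed (auto simp: q N_basis_pos)

end

subsection \<open>\<open>\<ell>\<^sub>q\<close>-sums of finite-dimensional \<open>\<ell>\<^sub>p\<close>-spaces\<close>

lemma sum_fun_apply2: "(\<Sum>i\<in>A. F i) n k = (\<Sum>i\<in>A. F i n k :: 'b::comm_monoid_add)"
  by (induction A rule: infinite_finite_induct) auto

text \<open>Writing the norm of a summand as a fold makes the laws of \<open>lq_fold\<close>
  available inside the rows too, with \<open>p\<close> in place of \<open>q\<close>.\<close>

definition row_norm :: "ereal \<Rightarrow> (nat \<Rightarrow> nat \<Rightarrow> real) \<Rightarrow> nat \<Rightarrow> real" where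
  "row_norm p v n = lq_fold p (\<lambda>k. \<bar>v n k\<bar>) (Suc n)"

lemma lp_fin_norm_eq_row_norm:
  assumes "1 \<le> p" shows "lp_fin_norm p (Suc n) (v n) = row_norm p v n"
  using assms
proof (cases rule: ereal_ge_1_cases)
  case infinite
  then show ?thesis
    using lq_fold_infty[of "\<lambda>k. \<bar>v n k\<bar>" n]
    by (simp add: lp_fin_norm_def row_norm_def lessThan_Suc_atMost del: lq_fold.simps)
next
  case (real r)
  then show ?thesis
    using lq_fold_ereal[of r "\<lambda>k. \<bar>v n k\<bar>" "Suc n"]
    by (simp add: lp_fin_norm_def row_norm_def del: lq_fold.simps)
qed

definition unit_vec :: "nat \<times> nat \<Rightarrow> nat \<Rightarrow> nat \<Rightarrow> real" where
  "unit_vec c n k = (if (n, k) = c then 1 else 0)"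

definition head :: "nat \<Rightarrow> (nat \<Rightarrow> nat \<Rightarrow> real) \<Rightarrow> nat \<Rightarrow> nat \<Rightarrow> real" where
  "head n v m = (if m < n then v m else 0)"

context
  fixes p q :: ereal
  assumes p: "1 \<le> p" and q: "1 \<le> q"
begin

lemma mixed_space_iff:
  "v \<in> mixed_space p q \<longleftrightarrow> (\<forall>n k. n < k \<longrightarrow> v n k = 0) \<and> row_norm p v \<in> lq_seqs q"
proof -
  have "0 \<le> row_norm p v n" for n unfolding row_norm_def by (rule lq_fold_nonneg) simp
  then show ?thesis
    by (auto simp: mixed_space_def lq_sum_def lp_fin_def lq_seqs_def lp_fin_norm_eq_row_norm[OF p] Suc_le_eq)
qed

lemma mixed_norm_eq: "mixed_norm p q v = lq_norm q (row_norm p v)"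
  by (simp add: mixed_norm_def lq_sum_norm_def lq_norm_def lp_fin_norm_eq_row_norm[OF p])

lemma row_norm_nonneg: "0 \<le> row_norm p v n"
  unfolding row_norm_def by (rule lq_fold_nonneg) simp

lemma row_norm_mono: "(\<And>k. \<bar>u n k\<bar> \<le> \<bar>v n k\<bar>) \<Longrightarrow> row_norm p u n \<le> row_norm p v n"
  unfolding row_norm_def using p by (intro lq_fold_mono) auto

lemma row_norm_triangle: "row_norm p (u + v) n \<le> row_norm p u n + row_norm p v n"
proof -
  have "row_norm p (u + v) n \<le> lq_fold p (\<lambda>k. \<bar>u n k\<bar> + \<bar>v n k\<bar>) (Suc n)"
    unfolding row_norm_def using p by (intro lq_fold_mono) auto
  also have "\<dots> \<le> row_norm p u n + row_norm p v n"
    unfolding row_norm_def using p by (intro lq_fold_triangle) auto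
  finally show ?thesis .
qed

lemma row_norm_scaleR: "row_norm p (c *\<^sub>R v) = (\<lambda>n. \<bar>c\<bar> * row_norm p v n)"
  unfolding row_norm_def using p lq_fold_mult[of p "\<lambda>k. \<bar>v _ k\<bar>" "\<bar>c\<bar>"]
  by (auto simp: abs_mult simp del: lq_fold.simps)

lemma abs_le_row_norm: "k \<le> n \<Longrightarrow> \<bar>v n k\<bar> \<le> row_norm p v n"
  unfolding row_norm_def using p by (intro lq_fold_ge) auto

lemma row_norm_zero: "(\<And>k. v n k = 0) \<Longrightarrow> row_norm p v n = 0"
  unfolding row_norm_def using p by (simp add: lq_fold_zero)

lemma abs_le_mixed_norm:
  assumes "v \<in> mixed_space p q" shows "\<bar>v n k\<bar> \<le> mixed_norm p q v"
proof -
  have r: "row_norm p v \<in> lq_seqs q" using assms by (simp add: mixed_space_iff)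
  show ?thesis
  proof (cases "k \<le> n")
    case True
    then have "\<bar>v n k\<bar> \<le> row_norm p v n" by (rule abs_le_row_norm)
    also have "\<dots> \<le> mixed_norm p q v" unfolding mixed_norm_eq by (rule lq_norm_ge[OF q r])
    finally show ?thesis .
  next
    case False
    then show ?thesis
      using assms lq_norm_nonneg[OF q r] by (simp add: mixed_space_iff mixed_norm_eq)
  qed
qed

lemma mixed_norm_mono:
  assumes "v \<in> mixed_space p q" "\<And>n k. \<bar>u n k\<bar> \<le> \<bar>v n k\<bar>"
  shows "u \<in> mixed_space p q" "mixed_norm p q u \<le> mixed_norm p q v"
proof -
  have le: "row_norm p u n \<le> row_norm p v n" for n using assms(2) by (intro row_norm_mono)
  have r: "row_norm p v \<in> lq_seqs q" using assms by (simp add: mixed_space_iff)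
  then have "row_norm p u \<in> lq_seqs q" by (rule lq_seqs_mono[OF q _ row_norm_nonneg le])
  moreover have "u n k = 0" if "n < k" for n k
    using assms(1) assms(2)[of n k] that by (simp add: mixed_space_iff)
  ultimately show "u \<in> mixed_space p q" by (simp add: mixed_space_iff)
  show "mixed_norm p q u \<le> mixed_norm p q v"
    unfolding mixed_norm_eq by (rule lq_norm_mono[OF q r row_norm_nonneg le])
qed

text \<open>This makes the sign change of a coordinate an isometry.\<close>

lemma mixed_norm_abs_cong:
  assumes "v \<in> mixed_space p q" "\<And>n k. \<bar>u n k\<bar> = \<bar>v n k\<bar>"
  shows "mixed_norm p q u = mixed_norm p q v"
  using mixed_norm_mono[of v u] mixed_norm_mono[of u v] assms by force

lemma normed_subspace_mixed: "normed_subspace (mixed_space p q) (mixed_norm p q)"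
proof
  let ?V = "mixed_space p q" and ?N = "mixed_norm p q"
  have row0: "row_norm p (0::nat \<Rightarrow> nat \<Rightarrow> real) n = 0" for n by (rule row_norm_zero) simp
  show "subspace ?V"
  proof (rule subspaceI)
    have "row_norm p (0::nat \<Rightarrow> nat \<Rightarrow> real) \<in> lq_seqs q"
      by (rule lq_seqs_finite[OF q, of _ 0]) (simp_all add: row0)
    then show "0 \<in> ?V" by (simp add: mixed_space_iff)
    fix u v assume uv: "u \<in> ?V" "v \<in> ?V"
    then have "(\<lambda>n. row_norm p u n + row_norm p v n) \<in> lq_seqs q"
      by (intro lq_seqs_add q) (auto simp: mixed_space_iff)
    then have "row_norm p (u + v) \<in> lq_seqs q"
      by (rule lq_seqs_mono[OF q]) (rule row_norm_nonneg row_norm_triangle)+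
    then show "u + v \<in> ?V" using uv by (simp add: mixed_space_iff)
  next
    fix c v assume "v \<in> ?V"
    then show "c *\<^sub>R v \<in> ?V"
      using lq_seqs_mult[OF q, of "row_norm p v" "\<bar>c\<bar>"] by (simp add: mixed_space_iff row_norm_scaleR)
  qed
  fix v assume v: "v \<in> ?V"
  then have r: "row_norm p v \<in> lq_seqs q" by (simp add: mixed_space_iff)
  show "0 \<le> ?N v" unfolding mixed_norm_eq using q r by (rule lq_norm_nonneg)
  show "v = 0" if "?N v = 0"
  proof (intro ext)
    show "v n k = 0 n k" for n k using abs_le_mixed_norm[OF v, of n k] that by simp
  qed
  show "?N (c *\<^sub>R v) = \<bar>c\<bar> * ?N v" for c
    using lq_norm_mult[OF q r, of "\<bar>c\<bar>"] by (simp add: mixed_norm_eq row_norm_scaleR)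
  fix u assume "u \<in> ?V"
  then have r': "row_norm p u \<in> lq_seqs q" by (simp add: mixed_space_iff)
  have "?N (u + v) \<le> lq_norm q (\<lambda>n. row_norm p u n + row_norm p v n)"
    unfolding mixed_norm_eq
    by (rule lq_norm_mono[OF q lq_seqs_add[OF q r' r] row_norm_nonneg row_norm_triangle])
  also have "\<dots> \<le> ?N u + ?N v" unfolding mixed_norm_eq by (rule lq_norm_triangle[OF q r' r])
  finally show "?N (u + v) \<le> ?N u + ?N v" .
qed

text \<open>The index set lists the coordinates of the first \<open>n\<close> summands, row m having
  the entries 0 to m. The splitting law is \<open>lq_norm_split\<close> for the row norms; the bound
  on heads uses \<open>lq_fold_le_sum\<close> across rows and within each row.\<close>

lemma lq_decomposition_mixed:
  "lq_decomposition (mixed_space p q) (mixed_norm p q) q head (\<lambda>n. SIGMA m:{..<n}. {..m})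
    (\<lambda>(n, k) v. v n k)"
proof (rule lq_decomposition.intro[OF normed_subspace_mixed], unfold_locales)
  let ?V = "mixed_space p q" and ?N = "mixed_norm p q"
  show "1 \<le> q" by (rule q)
  show "finite (SIGMA m:{..<n}. {..m})" for n :: nat by auto
  fix v :: "nat \<Rightarrow> nat \<Rightarrow> real" and n assume v: "v \<in> ?V"
  then have r: "row_norm p v \<in> lq_seqs q" by (simp add: mixed_space_iff)
  show "head n v \<in> ?V" by (rule mixed_norm_mono(1)[OF v]) (simp add: head_def)
  have rh: "row_norm p (head n v) = (\<lambda>m. if m < n then row_norm p v m else 0)" for n v
    using p by (auto simp: fun_eq_iff row_norm_def head_def lq_fold_zero)
  have rt: "row_norm p (v - head n v) = (\<lambda>m. if m < n then 0 else row_norm p v m)" for n v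
    using p by (auto simp: fun_eq_iff row_norm_def head_def lq_fold_zero)
  show "(\<lambda>n. ?N (v - head n v)) \<longlonglongrightarrow> 0"
    unfolding mixed_norm_eq rt by (rule lq_norm_tail_tendsto[OF q r])
  show "\<bar>(case c of (n, k) \<Rightarrow> \<lambda>v. v n k) v\<bar> \<le> ?N v" for c
    using abs_le_mixed_norm[OF v] by (cases c) simp
  show "?N (head n v) \<le> (\<Sum>c\<in>(SIGMA m:{..<n}. {..m}). \<bar>(case c of (n, k) \<Rightarrow> \<lambda>v. v n k) v\<bar>)"
  proof -
    have "?N (head n v) = lq_fold q (\<lambda>m. if m < n then row_norm p v m else 0) n"
      unfolding mixed_norm_eq rh using q by (rule lq_norm_finite) (auto simp: row_norm_nonneg)
    also have "\<dots> = lq_fold q (row_norm p v) n" by (rule lq_fold_cong) simp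
    also have "\<dots> \<le> (\<Sum>m<n. row_norm p v m)" using q row_norm_nonneg by (rule lq_fold_le_sum)
    also have "\<dots> \<le> (\<Sum>m<n. \<Sum>k\<in>{..m}. \<bar>v m k\<bar>)"
      unfolding row_norm_def lessThan_Suc_atMost[symmetric]
      using p by (intro sum_mono lq_fold_le_sum) auto
    also have "\<dots> = (\<Sum>c\<in>(SIGMA m:{..<n}. {..m}). \<bar>(case c of (n, k) \<Rightarrow> \<lambda>v. v n k) v\<bar>)"
      by (simp add: sum.Sigma case_prod_unfold)
    finally show ?thesis .
  qed
  fix u assume u: "u \<in> ?V"
  show "(case c of (n, k) \<Rightarrow> \<lambda>v. v n k) (\<alpha> *\<^sub>R u + \<beta> *\<^sub>R v)
      = \<alpha> * (case c of (n, k) \<Rightarrow> \<lambda>v. v n k) u + \<beta> * (case c of (n, k) \<Rightarrow> \<lambda>v. v n k) v" for c \<alpha> \<beta>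
    by (cases c) simp
  show "?N (head n u + (v - head n v)) = lq_add q (?N (head n u)) (?N (v - head n v))"
  proof -
    interpret normed_subspace ?V ?N by (rule normed_subspace_mixed)
    let ?w = "head n u + (v - head n v)"
    have "head n u \<in> ?V" by (rule mixed_norm_mono(1)[OF u]) (simp add: head_def)
    moreover have "head n v \<in> ?V" by (rule mixed_norm_mono(1)[OF v]) (simp add: head_def)
    ultimately have "?w \<in> ?V" using v by simp
    then have rw: "row_norm p ?w \<in> lq_seqs q" by (simp add: mixed_space_iff)
    have "row_norm p ?w = (\<lambda>m. if m < n then row_norm p u m else row_norm p v m)"
      by (auto simp: fun_eq_iff row_norm_def head_def)
    then show ?thesis
      unfolding mixed_norm_eq rh rt lq_norm_split[OF q rw, of n]
      by (auto intro!: arg_cong2[where f = "lq_add q"] arg_cong[where f = "lq_norm q"])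
  qed
qed

section \<open>Unit vectors and the forward direction\<close>

lemma unit_vec_in: "k \<le> n \<Longrightarrow> unit_vec (n, k) \<in> mixed_space p q"
  unfolding mixed_space_iff
proof
  assume "k \<le> n"
  then show "\<forall>m j. m < j \<longrightarrow> unit_vec (n, k) m j = 0" by (auto simp: unit_vec_def)
  show "row_norm p (unit_vec (n, k)) \<in> lq_seqs q"
    by (rule lq_seqs_finite[OF q row_norm_nonneg, of "Suc n"], rule row_norm_zero)
       (simp add: unit_vec_def)
qed

lemma mixed_norm_two_units:
  assumes "k \<le> n" "k' \<le> n" "k \<noteq> k'"
  shows "mixed_norm p q (a *\<^sub>R unit_vec (n, k) + b *\<^sub>R unit_vec (n, k')) = lq_add p \<bar>a\<bar> \<bar>b\<bar>"
proof -
  let ?u = "a *\<^sub>R unit_vec (n, k) + b *\<^sub>R unit_vec (n, k')"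
  have row: "row_norm p ?u m = 0" if "m \<noteq> n" for m
    using that by (intro row_norm_zero) (simp add: unit_vec_def)
  have "mixed_norm p q ?u = lq_fold q (row_norm p ?u) (Suc n)"
    unfolding mixed_norm_eq using row by (intro lq_norm_finite q row_norm_nonneg) auto
  also have "lq_fold q (row_norm p ?u) n = lq_fold q (\<lambda>_. 0) n"
    by (rule lq_fold_cong) (simp add: row)
  then have "lq_fold q (row_norm p ?u) (Suc n) = row_norm p ?u n"
    using q by (simp add: lq_fold_zero row_norm_nonneg)
  also have "\<dots> = lq_fold p (\<lambda>j. if j = k then \<bar>a\<bar> else if j = k' then \<bar>b\<bar> else 0) (Suc n)"
    unfolding row_norm_def using assms by (intro lq_fold_cong) (auto simp: unit_vec_def)
  also have "\<dots> = lq_add p (lq_fold p (\<lambda>j. if j = k then \<bar>a\<bar> else 0) (Suc n)) \<bar>b\<bar>"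
    using p assms
    by (subst lq_fold_insert[where k = k' and a = 0 and b = "\<bar>b\<bar>"])
       (auto intro!: arg_cong2[where f = "lq_add p"] lq_fold_cong simp del: lq_fold.simps)
  also have "lq_fold p (\<lambda>j. if j = k then \<bar>a\<bar> else 0) (Suc n) = lq_add p (lq_fold p (\<lambda>_. 0) (Suc n)) \<bar>a\<bar>"
    using p assms
    by (subst lq_fold_insert[where k = k and a = 0 and b = "\<bar>a\<bar>"])
       (auto intro!: arg_cong2[where f = "lq_add p"] lq_fold_cong simp del: lq_fold.simps)
  finally show ?thesis using p by (simp only: lq_fold_zero lq_add_0_left abs_ge_zero)
qed

theorem one_greedy_imp_eq:
  assumes greedy: "one_greedy_basis (mixed_space p q) (mixed_norm p q) x"
  shows "p = q"
proof -
  let ?V = "mixed_space p q" and ?N = "mixed_norm p q"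
  interpret lq_decomposition ?V ?N q head "\<lambda>n. SIGMA m:{..<n}. {..m}" "\<lambda>(n, k) v. v n k"
    by (rule lq_decomposition_mixed)
  interpret one_greedy_in_lq_decomposition ?V ?N q head "\<lambda>n. SIGMA m:{..<n}. {..m}" "\<lambda>(n, k) v. v n k" x
    by unfold_locales (use greedy in \<open>auto simp: greedy_basis_def\<close>)
  interpret lq_basis ?V ?N x q "?N (x 0)" by (rule lq_basis)
  show ?thesis
  proof (cases "q = 2")
    case True
    \<comment> \<open>Summand number 1 has dimension 2. The sum and the difference of its unit
      vectors both have norm 2^(1/p), so the parallelogram law gives 2^(2/p) = 2.\<close>
    let ?u = "unit_vec (1, 0)" and ?v = "unit_vec (1, 1)"
    have "(?N (?u + ?v))\<^sup>2 + (?N (?u - ?v))\<^sup>2 = 2 * (?N ?u)\<^sup>2 + 2 * (?N ?v)\<^sup>2"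
      using True by (intro parallelogram unit_vec_in) auto
    then have "(lq_add p 1 1)\<^sup>2 = 2"
      using mixed_norm_two_units[of 0 1 1 1 1] mixed_norm_two_units[of 0 1 1 1 "-1"]
        mixed_norm_two_units[of 0 1 1 1 0] mixed_norm_two_units[of 0 1 1 0 1] p by simp
    also have "2 = (lq_add q 1 1)\<^sup>2"
      using lq_add_powr[of 2 1 1] lq_add_nonneg[of 1 1 q] True by (simp add: powr_numeral)
    finally have "lq_add p 1 1 = lq_add q 1 1"
      by (simp add: power2_eq_iff_nonneg lq_add_nonneg)
    with p q show ?thesis by (rule lq_add_same_inject)
  next
    case False
    \<comment> \<open>Summand number 2 is the first that contains three unit vectors.\<close>
    let ?e = "\<lambda>k. unit_vec (2, k)" and ?f = "\<lambda>k v. v 2 k :: real"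
    have e_norm: "?N (?e k) = 1" if "k < 3" for k
      using mixed_norm_two_units[of k 2 "if k = 0 then 1 else 0" 1 0] that p by simp
    have ref: "reflection (?e k) (?f k)" if "k < 3" for k
      unfolding reflection_def
    proof (intro conjI ballI allI)
      show "?e k \<in> ?V" using that by (intro unit_vec_in) simp
      fix v assume v: "v \<in> ?V"
      show "\<bar>v 2 k\<bar> \<le> ?N v" using v by (rule abs_le_mixed_norm)
      show "?N (v - (2 * v 2 k) *\<^sub>R ?e k) = ?N v"
        by (rule mixed_norm_abs_cong[OF v]) (simp add: unit_vec_def)
    qed (simp_all add: unit_vec_def)
    obtain k m :: nat where km: "k < 3" "m < 3" "k \<noteq> m" "?N (?e k + ?e m) = lq_add q (?N (?e k)) (?N (?e m))"
      by (rule three_reflections[OF False ref]) (auto simp: unit_vec_def)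
    then have "lq_add p 1 1 = lq_add q 1 1"
      using mixed_norm_two_units[of k 2 m 1 1] by (simp add: e_norm)
    with p q show ?thesis by (rule lq_add_same_inject)
  qed
qed

end

text \<open>Here equal exponents matter: the new entry is extracted first from its row and then from
  the sequence of row norms, and both extractions use the same operation.\<close>

lemma mixed_norm_add_unit_vec:
  assumes p: "1 \<le> p" and w: "w \<in> mixed_space p p" and "k \<le> n" "w n k = 0"
  shows "mixed_norm p p (w + s *\<^sub>R unit_vec (n, k)) = lq_add p (mixed_norm p p w) \<bar>s\<bar>"
proof -
  let ?u = "w + s *\<^sub>R unit_vec (n, k)"
  interpret normed_subspace "mixed_space p p" "mixed_norm p p"
    using p p by (rule normed_subspace_mixed)
  have "?u \<in> mixed_space p p" using w assms unit_vec_in[OF p p, of k n] by simp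
  then have r: "row_norm p ?u \<in> lq_seqs p" by (simp add: mixed_space_iff[OF p p])
  have "row_norm p ?u n = lq_add p (lq_fold p ((\<lambda>j. \<bar>?u n j\<bar>)(k := 0)) (Suc n)) \<bar>s\<bar>"
    unfolding row_norm_def using assms by (intro lq_fold_insert) (auto simp: unit_vec_def)
  also have "lq_fold p ((\<lambda>j. \<bar>?u n j\<bar>)(k := 0)) (Suc n) = row_norm p w n"
    unfolding row_norm_def using assms(4) by (intro lq_fold_cong) (auto simp: unit_vec_def)
  finally have n: "row_norm p ?u n = lq_add p (row_norm p w n) \<bar>s\<bar>" .
  have "lq_norm p (row_norm p ?u) = lq_add p (lq_norm p ((row_norm p ?u)(n := row_norm p w n))) \<bar>s\<bar>"
    using n by (rule lq_norm_insert[OF p r]) (auto intro: row_norm_nonneg p)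
  also have "(row_norm p ?u)(n := row_norm p w n) = row_norm p w"
    by (auto simp: fun_eq_iff row_norm_def unit_vec_def)
  finally show ?thesis by (simp only: mixed_norm_eq[OF p p])
qed

text \<open>The triangular set of positions is enumerated by the natural numbers and the unit
  vectors are taken in this order. Once they are known to be a Schauder basis with the entries as
  coefficients, \<open>mixed_norm_add_unit_vec\<close> puts them in \<open>lq_basis\<close> with l =
  1.\<close>

theorem one_greedy_unit_vecs:
  assumes p: "1 \<le> p"
  shows "\<exists>x. one_greedy_basis (mixed_space p p) (mixed_norm p p) x"
proof -
  let ?V = "mixed_space p p" and ?N = "mixed_norm p p"
  define I where "I = {(n, k). k \<le> (n::nat)}"
  interpret lq_decomposition ?V ?N p head "\<lambda>n. SIGMA m:{..<n}. {..m}" "\<lambda>(n, k) v. v n k"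
    using p p by (rule lq_decomposition_mixed)
  have "infinite I"
  proof
    assume "finite I"
    moreover have "range (\<lambda>n. (n, 0)) \<subseteq> I" by (auto simp: I_def)
    ultimately have "finite (range (\<lambda>n::nat. (n, 0::nat)))" by (rule finite_subset[rotated])
    then show False by (simp add: finite_image_iff inj_on_def)
  qed
  then have b: "bij_betw (from_nat_into I) UNIV I" by (intro bij_betw_from_nat_into) auto
  define b where "b = from_nat_into I"
  have inj: "inj b" and ran: "range b = I" using b by (auto simp: bij_betw_def b_def)
  define x where "x i = unit_vec (b i)" for i
  have bI: "snd (b i) \<le> fst (b i)" for i
    using ran by (auto simp: I_def dest: equalityD1[THEN subsetD, OF _ rangeI[of b i]])
  have x_in: "x i \<in> ?V" for i using unit_vec_in[OF p p bI] by (simp add: x_def)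
  define c where "c v i = v (fst (b i)) (snd (b i))" for v :: "nat \<Rightarrow> nat \<Rightarrow> real" and i
  have cx: "c (x i) j = (if i = j then 1 else 0)" for i j
    using inj by (auto simp: c_def x_def unit_vec_def inj_eq)
  have c_sum: "c (\<Sum>i\<in>A. a i *\<^sub>R x i) j = (if j \<in> A then a j else 0)" if "finite A" for a A j
  proof -
    have "c (\<Sum>i\<in>A. a i *\<^sub>R x i) j = (\<Sum>i\<in>A. a i * c (x i) j)" by (simp add: c_def sum_fun_apply2)
    also have "\<dots> = (\<Sum>i\<in>A. if i = j then a i else 0)" by (intro sum.cong) (auto simp: cx)
    finally show ?thesis using that by simp
  qed
  have c_le: "\<bar>c v i\<bar> \<le> ?N v" if "v \<in> ?V" for v i
    unfolding c_def using that by (rule abs_le_mixed_norm[OF p p])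
  have lin: "(\<Sum>i\<in>A. a i *\<^sub>R x i) \<in> ?V" for a A using x_in by auto
  have lim: "(\<lambda>n. ?N (v - (\<Sum>i<n. c v i *\<^sub>R x i))) \<longlonglongrightarrow> 0" if v: "v \<in> ?V" for v
  proof (rule LIMSEQ_I)
    fix \<epsilon> :: real assume "0 < \<epsilon>"
    have "\<forall>\<^sub>F n in sequentially. ?N (v - head n v) < \<epsilon>"
      using P_tendsto[OF v] \<open>0 < \<epsilon>\<close> by (intro order_tendstoD) auto
    then obtain n where n: "?N (v - head n v) < \<epsilon>" by (auto simp: eventually_sequentially)
    \<comment> \<open>The first \<open>M\<close> basis vectors include all unit vectors of the first
      \<open>n\<close> summands. From then on the remainder is dominated entry by entry by
      \<open>v - head n v\<close>.\<close>
    have "finite (b -` (SIGMA m:{..<n}. {..m}))" using inj by (intro finite_vimageI) auto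
    then obtain M where M: "b -` (SIGMA m:{..<n}. {..m}) \<subseteq> {..<M}" using finite_nat_iff_bounded by blast
    have "norm (?N (v - (\<Sum>i<m. c v i *\<^sub>R x i)) - 0) < \<epsilon>" if "M \<le> m" for m
    proof -
      let ?s = "\<Sum>i<m. c v i *\<^sub>R x i"
      have "?N (v - ?s) \<le> ?N (v - head n v)"
      proof (rule mixed_norm_mono(2)[OF p p])
        show "v - head n v \<in> ?V" using v P_in by simp
        fix r k
        show "\<bar>(v - ?s) r k\<bar> \<le> \<bar>(v - head n v) r k\<bar>"
        proof (cases "k \<le> r")
          case False
          moreover have "(v - ?s) \<in> ?V" using v lin by simp
          ultimately show ?thesis by (simp add: mixed_space_iff[OF p p])
        next
          case True
          then have "(r, k) \<in> range b" by (simp add: ran I_def)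
          then obtain i where i: "b i = (r, k)" by (metis imageE)
          have "?s r k = (if i < m then v r k else 0)"
            using c_sum[of "{..<m}" "c v" i] i by (simp add: c_def)
          moreover have "i < m" if "r < n"
          proof -
            have "i \<in> b -` (SIGMA m:{..<n}. {..m})" using i True that by simp
            then show ?thesis using M \<open>M \<le> m\<close> by auto
          qed
          ultimately show ?thesis by (auto simp: head_def)
        qed
      qed
      moreover have "0 \<le> ?N (v - ?s)" using v lin by (intro N_nonneg) auto
      ultimately show ?thesis using n by simp
    qed
    then show "\<exists>M. \<forall>m\<ge>M. norm (?N (v - (\<Sum>i<m. c v i *\<^sub>R x i)) - 0) < \<epsilon>" by blast
  qed
  \<comment> \<open>From \<open>Suc j\<close> on, the partial sum has coordinate \<open>a j\<close>
    at place \<open>j\<close>, and each coordinate is bounded by the norm, so convergence forces the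
    coefficient.\<close>
  have uniq: "a = c v" if v: "v \<in> ?V" and a: "(\<lambda>n. ?N (v - (\<Sum>i<n. a i *\<^sub>R x i))) \<longlonglongrightarrow> 0" for v a
  proof
    fix j
    have "\<bar>c v j - a j\<bar> \<le> ?N (v - (\<Sum>i<n. a i *\<^sub>R x i))" if "Suc j \<le> n" for n
    proof -
      have "c (v - (\<Sum>i<n. a i *\<^sub>R x i)) j = c v j - c (\<Sum>i<n. a i *\<^sub>R x i) j" by (simp add: c_def)
      also have "\<dots> = c v j - a j" using c_sum[of "{..<n}" a j] that by simp
      finally show ?thesis using c_le[of "v - (\<Sum>i<n. a i *\<^sub>R x i)" j] v lin by simp
    qed
    then have "\<bar>c v j - a j\<bar> \<le> 0" using LIMSEQ_le_const[OF a] by blast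
    then show "a j = c v j" by simp
  qed
  interpret schauder_basis_space ?V ?N x
  proof
    show "schauder_basis ?V ?N x"
      unfolding schauder_basis_def
    proof (intro conjI allI ballI)
      fix v assume v: "v \<in> ?V"
      show "\<exists>!a. (\<lambda>n. ?N (v - (\<Sum>i<n. a i *\<^sub>R x i))) \<longlonglongrightarrow> 0"
        by (rule ex1I[of _ "c v"]) (rule lim[OF v], rule uniq[OF v])
    qed (rule x_in)
  qed
  have coeff: "coeff v = c v" if "v \<in> ?V" for v using coeff_unique[OF that lim[OF that]] .
  interpret lq_basis ?V ?N x p 1
  proof
    fix w i s assume "w \<in> ?V" "coeff w i = 0"
    then show "?N (w + s *\<^sub>R x i) = lq_add p (?N w) (\<bar>s\<bar> * 1)"
      using mixed_norm_add_unit_vec[OF p _ bI[of i], of w s] by (simp add: coeff c_def x_def)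
  qed (use p in auto)
  show ?thesis using one_greedy by blast
qed

theorem mainTheorem3:
  fixes p q :: ereal
  assumes "1 \<le> p" and "1 \<le> q"
  shows "(\<exists>x. one_greedy_basis (mixed_space p q) (mixed_norm p q) x) \<longleftrightarrow> p = q"
  using one_greedy_imp_eq[OF assms] one_greedy_unit_vecs[OF assms(1)] by blast

end
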